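(* Fix an integer $r\ge 2$. For every $q_0\in\mathbb{C}$ with $|q_0-1|=r$ and every $\epsilon>0$, there exists $n_0=n_0(q_0,\epsilon)$ such that for all $n\ge n_0$ the chromatic polynomial of $G_n^r$ has a root $q$ with $|q-q_0|<\epsilon$. In particular every point of the circle $|q-1|=r$ is a limit point of chromatic roots of the family $\{G_n^r\}_{n\ge1}$.
   Context: For integers $r\ge2$ and $n\ge1$, the leaf-joined tree $G_n^r$ is the graph obtained from the complete $r$-ary rooted tree of height $n$ (every internal vertex has exactly $r$ children and all leaves are at distance $n$ from the root) by identifying all leaves into a single vertex. The chromatic polynomial of a graph $G=(V,E)$ is $P_G(q)=\sum_{A\subseteq E}(-1)^{|A|}q^{k(A)}$, where $k(A)$ is the number of connected components of $(V,A)$; its roots in $\mathbb C$ are the chromatic roots of $G$. *)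

theory Defs
  imports "HOL-Analysis.Analysis" "HOL-Computational_Algebra.Polynomial"
begin

text \<open>A finite multigraph is given by a vertex set V, an edge set E and an
endpoint map ends :: 'e => 'v * 'v (parallel edges allowed).\<close>

definition comp_rel :: "'v set \<Rightarrow> ('e \<Rightarrow> 'v \<times> 'v) \<Rightarrow> 'e set \<Rightarrow> ('v \<times> 'v) set" where
  "comp_rel V ends A =
     (let R = {(fst (ends e), snd (ends e)) | e. e \<in> A} in (R \<union> R\<inverse>)\<^sup>* \<inter> (V \<times> V))"

definition num_components :: "'v set \<Rightarrow> ('e \<Rightarrow> 'v \<times> 'v) \<Rightarrow> 'e set \<Rightarrow> nat" where
  "num_components V ends A = card (V // comp_rel V ends A)"

text \<open>Chromatic polynomial via the subset expansion.\<close>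
definition chromatic_poly :: "'v set \<Rightarrow> 'e set \<Rightarrow> ('e \<Rightarrow> 'v \<times> 'v) \<Rightarrow> complex poly" where
  "chromatic_poly V E ends =
     (\<Sum>A\<in>Pow E. smult ((-1) ^ card A) (monom 1 (num_components V ends A)))"

text \<open>Leaf-joined tree G_n^r. Tree vertices are words over {0..<r} of length <= n
(root = [], children of xs are xs@[i]). Internal vertices (length < n) are
Some xs; all leaves (length = n) are identified to the single vertex None.
Each non-root tree vertex xs gives the edge from its parent butlast xs to
(the image of) xs.\<close>
definition leaf_tree_V :: "nat \<Rightarrow> nat \<Rightarrow> nat list option set" where
  "leaf_tree_V r n = {Some xs | xs. length xs < n \<and> set xs \<subseteq> {..<r}} \<union> {None}"

definition leaf_tree_E :: "nat \<Rightarrow> nat \<Rightarrow> nat list set" where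
  "leaf_tree_E r n = {xs. 1 \<le> length xs \<and> length xs \<le> n \<and> set xs \<subseteq> {..<r}}"

definition leaf_tree_ends :: "nat \<Rightarrow> nat list \<Rightarrow> nat list option \<times> nat list option" where
  "leaf_tree_ends n xs = (Some (butlast xs), if length xs = n then None else Some xs)"

definition leaf_tree_chrom :: "nat \<Rightarrow> nat \<Rightarrow> complex poly" where
  "leaf_tree_chrom r n = chromatic_poly (leaf_tree_V r n) (leaf_tree_E r n) (leaf_tree_ends n)"

end

theory Submission
  imports Defs "HOL-Complex_Analysis.Complex_Analysis"
begin

text \<open>Counting colourings level by level expresses the chromatic polynomial of the leaf-joined tree through
the critical orbit \<open>u\<^sub>m(q)\<close> of the map \<open>u \<mapsto> (q - 1) / (u\<^sup>r + q - 2)\<close>, which has the fixed point \<open>1\<close>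
with multiplier \<open>- r / (q - 1)\<close>. Outside the circle \<open>|q - 1| = r\<close> this fixed point is attracting, and by
Fatou's theorem \<open>u\<^sub>m(q)\<close> converges to it at the exponential rate \<open>r / |q - 1|\<close>. If for infinitely many heights
there were no chromatic root near a point of the circle, the corresponding \<open>u\<^sub>m\<close> would omit three holomorphic
functions there, namely second preimages of \<open>1 - q\<close>. By Schottky's theorem \<open>u\<^sub>m - 1\<close> is then bounded, in a suitable
Moebius coordinate, on both sides of the circle. But the rate \<open>log r - log |q - 1|\<close> is harmonic and becomes
positive inside the circle, which contradicts the maximum principle.\<close>

section \<open>Holomorphic roots and Schottky's theorem\<close>

text \<open>Apart from \<open>q = 0\<close> and \<open>q = 1\<close>, a chromatic root of the tree
  of height \<open>m + 1\<close> is a \<open>q\<close> with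
  \<open>u\<^sub>m(q)\<^sup>r = 1 - q\<close>. Since \<open>u\<^sub>m\<close> has poles, it must
  omit three functions, and for \<open>r = 2\<close> this equation supplies only two. One more
  preimage is enough: two branches over one \<open>r\<close>-th root of \<open>1 - q\<close> and a
  third over another. The Moebius coordinate is \<open>(u - 1) / (u - \<delta>)\<close> with
  \<open>\<delta>\<close> one of the omitted functions. It makes \<open>u\<^sub>m\<close>
  holomorphic and puts the fixed point at \<open>0\<close>, so that convergence is decay of a
  modulus. Schottky's theorem needs control at one point. The disc is therefore centred outside the
  circle, where the orbit converges, and is large enough to reach across it. Two degeneracies have
  to be avoided. The radicands of the branches may vanish for finitely many \<open>q\<close>, so the
  given point of the circle is first moved slightly. The lower bound for the rate fails if the orbit
  lands exactly on \<open>1\<close>, so it is taken at a point off the countably many zeros of all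
  \<open>u\<^sub>m - 1\<close>.\<close>

lemma holomorphic_nth_root_exists:
  fixes f :: "complex \<Rightarrow> complex"
  assumes "f holomorphic_on S" "convex S" "open S" "\<And>z. z \<in> S \<Longrightarrow> f z \<noteq> 0"
    and "n > 0" "c \<in> S" "w ^ n = f c"
  obtains g where "g holomorphic_on S" "\<And>z. z \<in> S \<Longrightarrow> g z ^ n = f z" "g c = w"
proof -
  obtain l where l: "l holomorphic_on S" "\<And>z. z \<in> S \<Longrightarrow> exp (l z) = f z"
    using holomorphic_logarithm_exists[of S f c] assms by auto
  define g where "g = (\<lambda>z. w * exp ((l z - l c) / of_nat n))"
  have "g holomorphic_on S"
    unfolding g_def by (intro holomorphic_intros l) (use assms in auto)
  moreover have "g z ^ n = f z" if "z \<in> S" for z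
  proof -
    have "g z ^ n = w ^ n * exp (of_nat n * ((l z - l c) / of_nat n))"
      by (simp only: g_def power_mult_distrib exp_of_nat_mult)
    also have "\<dots> = f c * (exp (l z) / exp (l c))"
      using assms by (simp add: exp_diff)
    also have "\<dots> = f z"
      using l assms that by simp
    finally show ?thesis .
  qed
  moreover have "g c = w"
    by (simp add: g_def)
  ultimately show thesis
    using that by blast
qed

text \<open>The quotient \<open>(f - a) / (b - a)\<close> omits \<open>0\<close> and
  \<open>1\<close>, which reduces moving targets to the classical theorem on the unit disc. The
  bound is chosen before \<open>f\<close>, so it serves a whole sequence of functions at
  once.\<close>

lemma Schottky_two_functions:
  fixes a b :: "complex \<Rightarrow> complex"
  assumes hol: "a holomorphic_on cball c R" "b holomorphic_on cball c R"
    and "\<And>z. z \<in> cball c R \<Longrightarrow> a z \<noteq> b z"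
    and "R > 0" "0 < t" "t < 1"
  shows "\<exists>C. \<forall>f z. f holomorphic_on cball c R \<longrightarrow> (\<forall>z\<in>cball c R. f z \<noteq> a z \<and> f z \<noteq> b z) \<longrightarrow>
     norm (f c) \<le> K \<longrightarrow> dist c z \<le> t * R \<longrightarrow> norm (f z) \<le> C"
proof -
  have "bounded (a ` cball c R)" "bounded (b ` cball c R)"
    using hol by (auto intro!: compact_imp_bounded compact_continuous_image holomorphic_on_imp_continuous_on)
  then obtain Ca Cb where Cab: "\<And>z. z \<in> cball c R \<Longrightarrow> norm (a z) \<le> Ca" "\<And>z. z \<in> cball c R \<Longrightarrow> norm (b z) \<le> Cb"
    unfolding bounded_iff by (metis imageI)
  define r where "r = (K + Ca) / norm (b c - a c)"
  define B where "B = exp (pi * exp (pi * (2 + 2 * r + 12 * t / (1 - t))))"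
  show ?thesis
  proof (intro exI[of _ "Ca + (Cb + Ca) * B"] allI impI)
    fix f z
    assume f: "f holomorphic_on cball c R" 
      and omit: "\<forall>z\<in>cball c R. f z \<noteq> a z \<and> f z \<noteq> b z"
      and fc: "norm (f c) \<le> K" and z: "dist c z \<le> t * R"
    define T where "T = (\<lambda>x. c + of_real R * x :: complex)"
    have T: "T x \<in> cball c R" if "x \<in> cball 0 1" for x
      using that \<open>R > 0\<close> by (auto simp: T_def dist_norm norm_mult)
    have hT: "(\<lambda>x. h (T x)) holomorphic_on cball 0 1" if "h holomorphic_on cball c R" for h
    proof -
      have "h \<circ> T holomorphic_on cball 0 1"
        by (rule holomorphic_on_compose_gen[OF _ that]) (auto simp: T_def intro!: holomorphic_intros T[unfolded T_def])
      then show ?thesis by (simp add: o_def)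
    qed
    define v where "v = (\<lambda>x. (f (T x) - a (T x)) / (b (T x) - a (T x)))"
    define x where "x = (z - c) / of_real R"
    have Tx: "T x = z"
      using \<open>R > 0\<close> by (simp add: T_def x_def)
    have nx: "norm x \<le> t"
      using z \<open>R > 0\<close> by (simp add: x_def norm_divide dist_norm norm_minus_commute field_simps)
    have zc: "z \<in> cball c R"
      using T[of x] nx \<open>t < 1\<close> Tx by auto
    have cc: "c \<in> cball c R"
      using \<open>R > 0\<close> by simp
    have "norm (v x) \<le> B"
      unfolding B_def
    proof (rule Schottky[of v r t x])
      show "v holomorphic_on cball 0 1"
        unfolding v_def by (intro holomorphic_intros hT f hol) (use assms(3) T in force)
      have "norm (v 0) = norm (f c - a c) / norm (b c - a c)"
        by (simp add: v_def T_def norm_divide)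
      also have "\<dots> \<le> r"
        unfolding r_def using fc Cab(1)[OF cc] norm_triangle_ineq4[of "f c" "a c"]
        by (intro divide_right_mono) auto
      finally show "norm (v 0) \<le> r" .
      show "\<not> (v y = 0 \<or> v y = 1)" if "y \<in> cball 0 1" for y
        using bspec[OF omit T[OF that]] assms(3)[OF T[OF that]] by (auto simp: v_def)
    qed (use assms nx in auto)
    moreover have "f z = a z + (b z - a z) * v x"
      using assms(3)[OF zc] by (simp add: v_def Tx)
    moreover have "norm (b z - a z) \<le> Cb + Ca"
      using Cab[OF zc] norm_triangle_ineq4[of "b z" "a z"] by linarith
    ultimately show "norm (f z) \<le> Ca + (Cb + Ca) * B"
      using Cab(1)[OF zc] norm_triangle_ineq[of "a z" "(b z - a z) * v x"]
        mult_mono[of "norm (b z - a z)" "Cb + Ca" "norm (v x)" B]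
      by (simp add: norm_mult) (smt (verit) norm_ge_zero)
  qed
qed

section \<open>The critical orbit\<close>

text \<open>Let \<open>S\<close> and \<open>D\<close> count the proper \<open>q\<close>-colourings of \<open>G\<^sub>m\<close> in which the joined leaf has a given
colour and the root has the same, respectively a given different, colour. Then numerator and denominator
below are \<open>(q - 1) D\<close> and \<open>S + (q - 2) D\<close>, so that one more level of the tree has \<open>S = num\<^sup>r\<close> and
\<open>D = den\<^sup>r\<close>. Their quotient is the orbit of the critical point \<open>0\<close> under
\<open>u \<mapsto> (q - 1) / (u\<^sup>r + q - 2)\<close>; keeping the pair of polynomials takes care of the value \<open>\<infinity>\<close>.\<close>

fun orbit_num orbit_den :: "nat \<Rightarrow> nat \<Rightarrow> complex poly" where
  "orbit_num r 0 = 0"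
| "orbit_den r 0 = 1"
| "orbit_num r (Suc m) = [:-1, 1:] * orbit_den r m ^ r"
| "orbit_den r (Suc m) = orbit_num r m ^ r + [:-2, 1:] * orbit_den r m ^ r"

lemma poly_orbit_num_Suc:
  "poly (orbit_num r (Suc m)) q = (q - 1) * poly (orbit_den r m) q ^ r"
  by (simp add: algebra_simps)

lemma poly_orbit_den_Suc:
  "poly (orbit_den r (Suc m)) q = poly (orbit_num r m) q ^ r + (q - 2) * poly (orbit_den r m) q ^ r"
  by (simp add: algebra_simps)

declare orbit_num.simps(2) [simp del] orbit_den.simps(2) [simp del]

text \<open>The pair is thus a genuine point of the projective line: if \<open>orbit_den\<close>
  vanishes at one step, the nonzero \<open>orbit_num\<close> makes it nonzero at the next.\<close>

lemma orbit_no_common_zero: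
  assumes "q \<noteq> 1"
  shows "poly (orbit_num r m) q \<noteq> 0 \<or> poly (orbit_den r m) q \<noteq> 0"
proof (induction m)
  case (Suc m)
  then show ?case
    using assms by (cases "poly (orbit_den r m) q = 0") (auto simp: poly_orbit_num_Suc poly_orbit_den_Suc power_0_left)
qed simp

text \<open>This is Fatou's theorem that an attracting cycle attracts a critical point: if the orbit avoids a disc
around the fixed point \<open>1\<close>, then all iterated inverse branches fixing \<open>1\<close> exist there. They omit \<open>0\<close> and
\<open>(q - 1) / (q - 2)\<close>, so Schottky's theorem bounds them, while their derivatives at \<open>1\<close> grow geometrically.\<close>

lemma orbit_enters_disc:
  assumes "r \<ge> 2" and q: "cmod (q - 1) > real r" and "\<delta> > 0"
  obtains j where "poly (orbit_den r j) q \<noteq> 0"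
    "cmod (poly (orbit_num r j) q / poly (orbit_den r j) q - 1) < \<delta>"
proof (rule ccontr)
  assume "\<not> thesis"
  with that have far: "poly (orbit_den r j) q = 0 \<or>
      cmod (poly (orbit_num r j) q / poly (orbit_den r j) q - 1) \<ge> \<delta>" for j
    by force
  have q1: "q \<noteq> 1" and q2: "q \<noteq> 2"
    using q \<open>r \<ge> 2\<close> by auto
  define D where "D = ball (1::complex) \<delta>"
  have D: "open D" "convex D" "1 \<in> D"
    using \<open>\<delta> > 0\<close> by (auto simp: D_def)
  \<comment> \<open>Cross-multiplied, the claim also covers orbit points at infinity, where
    \<open>orbit_den\<close> vanishes.\<close>
  have avoid: "y * poly (orbit_den r j) q \<noteq> poly (orbit_num r j) q" if "y \<in> D" for y j
  proof
    assume eq: "y * poly (orbit_den r j) q = poly (orbit_num r j) q"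
    then have "poly (orbit_den r j) q \<noteq> 0"
      using orbit_no_common_zero[OF q1, of r j] by auto
    with eq far[of j] that show False
      by (simp add: D_def dist_norm norm_minus_commute field_simps flip: eq)
  qed
  \<comment> \<open>Here \<open>g\<close> is the \<open>n\<close>-th iterated inverse branch, so its
    derivative at \<open>1\<close> is the reciprocal multiplier to the power \<open>n\<close>.
    Omitting the whole orbit is the invariant that keeps the induction going: index \<open>0\<close>
    permits division by \<open>g\<close>, index \<open>1\<close> keeps the next radicand nonzero,
    and if \<open>h\<close> met the orbit at \<open>j\<close>, then \<open>g\<close> would meet it
    at \<open>Suc j\<close>.\<close>
  have branch: "\<exists>g. g holomorphic_on D \<and> g 1 = 1 \<and> deriv g 1 = (- (q - 1) / of_nat r) ^ n \<and>
      (\<forall>y\<in>D. \<forall>j. g y * poly (orbit_den r j) q \<noteq> poly (orbit_num r j) q)" for n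
  proof (induction n)
    case 0
    show ?case
      using avoid by (intro exI[of _ "\<lambda>y. y"]) (auto intro!: holomorphic_intros)
  next
    case (Suc n)
    then obtain g where g: "g holomorphic_on D" "g 1 = 1" "deriv g 1 = (- (q - 1) / of_nat r) ^ n"
      and omit: "\<And>y j. y \<in> D \<Longrightarrow> g y * poly (orbit_den r j) q \<noteq> poly (orbit_num r j) q"
      by blast
    have g0: "g y \<noteq> 0" if "y \<in> D" for y
      using omit[OF that, of 0] by simp
    have gv: "g y * (q - 2) \<noteq> q - 1" if "y \<in> D" for y
      using omit[OF that, of 1] \<open>r \<ge> 2\<close> by (simp add: poly_orbit_num_Suc poly_orbit_den_Suc power_0_left)
    obtain h where h: "h holomorphic_on D" "\<And>y. y \<in> D \<Longrightarrow> h y ^ r = (q - 1) / g y - (q - 2)" "h 1 = 1"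
    proof (rule holomorphic_nth_root_exists[of "\<lambda>y. (q - 1) / g y - (q - 2)" D r 1 1])
      show "(\<lambda>y. (q - 1) / g y - (q - 2)) holomorphic_on D"
        by (intro holomorphic_intros g) (use g0 in auto)
      show "(q - 1) / g y - (q - 2) \<noteq> 0" if "y \<in> D" for y
        using g0[OF that] gv[OF that] by (simp add: field_simps)
    qed (use D g \<open>r \<ge> 2\<close> in auto)
    have gh: "g y * (h y ^ r + (q - 2)) = q - 1" if "y \<in> D" for y
      using h(2)[OF that] g0[OF that] by simp
    have homit: "h y * poly (orbit_den r j) q \<noteq> poly (orbit_num r j) q" if "y \<in> D" for y j
    proof
      assume eq: "h y * poly (orbit_den r j) q = poly (orbit_num r j) q"
      have "g y * poly (orbit_den r (Suc j)) q = g y * (h y ^ r + (q - 2)) * poly (orbit_den r j) q ^ r"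
        by (simp add: poly_orbit_den_Suc power_mult_distrib algebra_simps flip: eq)
      also have "\<dots> = poly (orbit_num r (Suc j)) q"
        by (simp only: gh[OF that] poly_orbit_num_Suc)
      finally have "g y * poly (orbit_den r (Suc j)) q = poly (orbit_num r (Suc j)) q" .
      with omit[OF that] show False by blast
    qed
    have dh: "deriv h 1 = (- (q - 1) / of_nat r) ^ Suc n"
    proof -
      have dg: "(g has_field_derivative deriv g 1) (at 1)" 
        using holomorphic_derivI[OF g(1) D(1) D(3)] .
      have dh: "(h has_field_derivative deriv h 1) (at 1)" 
        using holomorphic_derivI[OF h(1) D(1) D(3)] .
      have "((\<lambda>y. g y * (h y ^ r + (q - 2)) - (q - 1)) has_field_derivative
          (of_nat r * deriv h 1 + deriv g 1 + (q - 2) * deriv g 1)) (at 1)"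
        by (rule derivative_eq_intros refl dg dh | simp add: g(2) h(3) algebra_simps)+
      moreover have "((\<lambda>y. 0) has_field_derivative
          (of_nat r * deriv h 1 + deriv g 1 + (q - 2) * deriv g 1)) (at 1)"
        by (rule has_field_derivative_transform_within_open[OF calculation D(1) D(3)])
          (simp add: gh)
      then have "of_nat r * deriv h 1 + deriv g 1 + (q - 2) * deriv g 1 = 0"
        using DERIV_unique DERIV_const by blast
      then have "of_nat r * deriv h 1 = - (q - 1) * deriv g 1"
        by (simp add: algebra_simps add_eq_0_iff)
      then show ?thesis
        using \<open>r \<ge> 2\<close> g(3) by (simp add: field_simps)
    qed
    show ?case
      using h(1,3) dh homit by (intro exI[of _ h] conjI ballI allI)
  qed
  define b where "b = (q - 1) / (q - 2)"
  have "b \<noteq> 0"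
    using q1 q2 by (simp add: b_def)
  then have "\<And>z. z \<in> cball 1 (\<delta>/2) \<Longrightarrow> 0 \<noteq> b" by simp
  then have "\<exists>C. \<forall>g z. g holomorphic_on cball 1 (\<delta>/2) \<longrightarrow>
     (\<forall>z\<in>cball 1 (\<delta>/2). g z \<noteq> 0 \<and> g z \<noteq> b) \<longrightarrow> norm (g 1) \<le> 1 \<longrightarrow> dist 1 z \<le> 1/2 * (\<delta>/2)
      \<longrightarrow> norm (g z) \<le> C"
    by (intro Schottky_two_functions) (use \<open>\<delta> > 0\<close> in auto)
  then obtain C where C: "\<forall>g z. g holomorphic_on cball 1 (\<delta>/2) \<longrightarrow>
     (\<forall>z\<in>cball 1 (\<delta>/2). g z \<noteq> 0 \<and> g z \<noteq> b) \<longrightarrow> norm (g 1) \<le> 1 \<longrightarrow> dist 1 z \<le> 1/2 * (\<delta>/2)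
      \<longrightarrow> norm (g z) \<le> C" ..
  have "1 < cmod (q - 1) / r"
    using q \<open>r \<ge> 2\<close> by (simp add: field_simps)
  \<comment> \<open>Cauchy's inequality on the disc of radius \<open>\<delta>/4\<close> allows the
    derivative at most this quotient; \<open>n\<close> is taken beyond it.\<close>
  then obtain n where n: "C / (\<delta>/4) < (cmod (q - 1) / r) ^ n"
    using real_arch_pow by blast
  obtain g where g: "g holomorphic_on D" "g 1 = 1" "deriv g 1 = (- (q - 1) / of_nat r) ^ n"
      and omit: "\<And>y j. y \<in> D \<Longrightarrow> g y * poly (orbit_den r j) q \<noteq> poly (orbit_num r j) q"
    using branch[of n] by blast
  have sub: "cball 1 (\<delta>/2) \<subseteq> D"
    using \<open>\<delta> > 0\<close> by (auto simp: D_def)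
  have hol: "g holomorphic_on cball 1 (\<delta>/2)"
    using g(1) sub holomorphic_on_subset by blast
  have gC: "norm (g z) \<le> C" if "dist 1 z \<le> \<delta>/4" for z
  proof (rule C[rule_format, OF hol])
    fix y :: complex assume "y \<in> cball 1 (\<delta>/2)"
    then have "y \<in> D" using sub by auto
    then show "g y \<noteq> 0 \<and> g y \<noteq> b"
      using omit[OF \<open>y \<in> D\<close>, of 0] omit[OF \<open>y \<in> D\<close>, of 1] q2 \<open>r \<ge> 2\<close>
      by (auto simp: b_def poly_orbit_num_Suc poly_orbit_den_Suc power_0_left)
  qed (use g(2) that in simp_all)
  have "norm ((deriv ^^ 1) g 1) \<le> fact 1 * C / (\<delta>/4) ^ 1"
  proof (rule Cauchy_inequality)
    show "g holomorphic_on ball 1 (\<delta>/4)"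
      by (rule holomorphic_on_subset[OF hol]) (use \<open>\<delta> > 0\<close> in auto)
    show "continuous_on (cball 1 (\<delta>/4)) g"
      by (rule holomorphic_on_imp_continuous_on, rule holomorphic_on_subset[OF hol]) (use \<open>\<delta> > 0\<close> in auto)
  qed (use gC \<open>\<delta> > 0\<close> in \<open>auto simp: dist_norm\<close>)
  then have "(cmod (q - 1) / r) ^ n \<le> C / (\<delta>/4)"
    by (simp add: g(3) norm_power norm_divide norm_minus_commute)
  with n show False by simp
qed

text \<open>The quotient \<open>(F y - 1) / (y - 1)\<close> for \<open>F y = (q - 1) / (y\<^sup>r + q - 2)\<close>, extended continuously to \<open>y = 1\<close>.\<close>

definition slope :: "nat \<Rightarrow> complex \<Rightarrow> complex \<Rightarrow> complex" where
  "slope r q y = - (\<Sum>i<r. y ^ i) / (y ^ r + q - 2)"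

lemma orbit_step:
  fixes r m q
  defines "y \<equiv> poly (orbit_num r m) q / poly (orbit_den r m) q"
  assumes M: "poly (orbit_den r m) q \<noteq> 0" and y: "y ^ r + q - 2 \<noteq> 0"
  shows "poly (orbit_den r (Suc m)) q \<noteq> 0"
    and "poly (orbit_num r (Suc m)) q / poly (orbit_den r (Suc m)) q - 1 = slope r q y * (y - 1)"
proof -
  let ?M = "poly (orbit_den r m) q"
  have "poly (orbit_num r m) q = y * ?M"
    using M by (simp add: y_def)
  then have den: "poly (orbit_den r (Suc m)) q = (y ^ r + q - 2) * ?M ^ r"
    by (simp add: poly_orbit_den_Suc power_mult_distrib algebra_simps)
  then show "poly (orbit_den r (Suc m)) q \<noteq> 0"
    using M y by simp
  have "poly (orbit_num r (Suc m)) q / poly (orbit_den r (Suc m)) q - 1 = (1 - y ^ r) / (y ^ r + q - 2)"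
    using M y by (simp add: den poly_orbit_num_Suc divide_diff_eq_iff)
  also have "1 - y ^ r = - (\<Sum>i<r. y ^ i) * (y - 1)"
    by (simp add: one_diff_power_eq algebra_simps)
  also have "\<dots> / (y ^ r + q - 2) = slope r q y * (y - 1)"
    by (simp add: slope_def)
  finally show "poly (orbit_num r (Suc m)) q / poly (orbit_den r (Suc m)) q - 1 = slope r q y * (y - 1)" .
qed

section \<open>Rates of convergence to the fixed point outside the circle\<close>

lemma slope_bounds:
  assumes "q1 \<noteq> 1" "\<mu>1 < real r / cmod (q1 - 1)" "real r / cmod (q1 - 1) < \<mu>2"
  obtains \<delta> where "\<delta> > 0"
    "\<And>q y. dist q q1 < \<delta> \<Longrightarrow> dist y 1 < \<delta> \<Longrightarrow>
       y ^ r + q - 2 \<noteq> 0 \<and> \<mu>1 < cmod (slope r q y) \<and> cmod (slope r q y) < \<mu>2"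
proof -
  let ?p = "(q1, 1::complex)"
  have "isCont (\<lambda>p. snd p ^ r + fst p - 2) ?p"
    by (intro continuous_intros)
  then have ev1: "\<forall>\<^sub>F p in nhds ?p. snd p ^ r + fst p - 2 \<noteq> 0"
    using assms(1) by (intro tendsto_imp_eventually_ne) (auto simp: isCont_def tendsto_nhds_iff)
  have cont: "isCont (\<lambda>p. cmod (slope r (fst p) (snd p))) ?p"
    unfolding slope_def by (intro continuous_intros) (use assms(1) in auto)
  \<comment> \<open>At \<open>y = 1\<close> the slope is the multiplier
    \<open>- r / (q1 - 1)\<close>; continuity in both variables does the rest.\<close>
  have val: "cmod (slope r q1 1) = real r / cmod (q1 - 1)"
    by (simp add: slope_def norm_divide algebra_simps)
  have "((\<lambda>p. cmod (slope r (fst p) (snd p))) \<longlongrightarrow> real r / cmod (q1 - 1)) (nhds ?p)"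
    using cont val by (simp add: isCont_def tendsto_nhds_iff)
  from order_tendstoD[OF this] assms(2,3)
  have ev2: "\<forall>\<^sub>F p in nhds ?p. \<mu>1 < cmod (slope r (fst p) (snd p))"
    and ev3: "\<forall>\<^sub>F p in nhds ?p. cmod (slope r (fst p) (snd p)) < \<mu>2"
    by blast+
  obtain d where d: "d > 0" "\<And>p. dist p ?p < d \<Longrightarrow> snd p ^ r + fst p - 2 \<noteq> 0 \<and>
      \<mu>1 < cmod (slope r (fst p) (snd p)) \<and> cmod (slope r (fst p) (snd p)) < \<mu>2"
    using eventually_conj[OF ev1 eventually_conj[OF ev2 ev3]] unfolding eventually_nhds_metric by blast
  show thesis
  proof (rule that[of "d / 2"])
    fix q y :: complex
    assume "dist q q1 < d / 2" "dist y 1 < d / 2"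
    then have "dist (q, y) ?p < d"
      using sqrt_sum_squares_le_sum[of "dist q q1" "dist y 1"] by (simp add: dist_Pair_Pair)
    from d(2)[OF this] show "y ^ r + q - 2 \<noteq> 0 \<and> \<mu>1 < cmod (slope r q y) \<and> cmod (slope r q y) < \<mu>2"
      by simp
  qed (use d in auto)
qed

text \<open>Because \<open>\<mu>2 \<le> 1\<close>, the disc is mapped into itself, so the slope
  bounds apply at every later step and multiply up.\<close>

lemma orbit_geometric:
  fixes r q
  defines "u \<equiv> (\<lambda>m. poly (orbit_num r m) q / poly (orbit_den r m) q)"
  assumes slope: "\<And>y. dist y 1 < \<delta> \<Longrightarrow>
       y ^ r + q - 2 \<noteq> 0 \<and> \<mu>1 < cmod (slope r q y) \<and> cmod (slope r q y) < \<mu>2"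
    and "0 \<le> \<mu>1" "\<mu>2 \<le> 1"
    and start: "poly (orbit_den r j) q \<noteq> 0" "dist (u j) 1 < \<delta>"
  shows "poly (orbit_den r (j + k)) q \<noteq> 0 \<and> dist (u (j + k)) 1 < \<delta> \<and>
     \<mu>1 ^ k * cmod (u j - 1) \<le> cmod (u (j + k) - 1) \<and> cmod (u (j + k) - 1) \<le> \<mu>2 ^ k * cmod (u j - 1)"
proof (induction k)
  case 0
  show ?case using start by simp
next
  case (Suc k)
  let ?y = "u (j + k)"
  have y: "?y ^ r + q - 2 \<noteq> 0" "\<mu>1 < cmod (slope r q ?y)" "cmod (slope r q ?y) < \<mu>2"
    using Suc slope by blast+
  have step: "poly (orbit_den r (j + Suc k)) q \<noteq> 0" "u (j + Suc k) - 1 = slope r q ?y * (?y - 1)"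
    using orbit_step[of r "j + k" q] Suc y(1) by (simp_all add: u_def)
  then have eq: "cmod (u (j + Suc k) - 1) = cmod (slope r q ?y) * cmod (?y - 1)"
    by (simp add: norm_mult)
  have "cmod (u (j + Suc k) - 1) \<le> 1 * cmod (?y - 1)"
    unfolding eq by (intro mult_right_mono) (use y assms(4) in auto)
  then have "dist (u (j + Suc k)) 1 < \<delta>"
    using Suc by (simp add: dist_norm)
  moreover have "\<mu>1 * (\<mu>1 ^ k * cmod (u j - 1)) \<le> cmod (slope r q ?y) * cmod (?y - 1)"
    by (rule mult_mono) (use Suc.IH y assms(3) in auto)
  moreover have "0 \<le> \<mu>2"
    using y norm_ge_zero[of "slope r q ?y"] by linarith
  then have "cmod (slope r q ?y) * cmod (?y - 1) \<le> \<mu>2 * (\<mu>2 ^ k * cmod (u j - 1))"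
    by (intro mult_mono) (use Suc.IH y in auto)
  ultimately show ?case using step(1) unfolding eq by (simp add: mult.assoc)
qed

text \<open>The orbit may wander before it enters the contracting disc. The entry time
  \<open>j\<close> found at \<open>q1\<close> persists nearby by continuity, and the slack
  \<open>\<eta>\<close> pays both for these \<open>j\<close> steps and for the variation of
  \<open>q\<close>.\<close>

lemma orbit_upper_local:
  assumes "r \<ge> 2" and q1: "cmod (q1 - 1) > real r" and "\<eta> > 0"
  obtains \<epsilon> n0 where "\<epsilon> > 0" "\<And>q n. \<lbrakk>dist q q1 < \<epsilon>; n \<ge> n0\<rbrakk> \<Longrightarrow> poly (orbit_den r n) q \<noteq> 0 \<and>
    cmod (poly (orbit_num r n) q / poly (orbit_den r n) q - 1) \<le> (exp \<eta> * (r / cmod (q - 1))) ^ n"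
proof -
  define L where "L = r / cmod (q1 - 1)"
  have "q1 \<noteq> 1" using q1 \<open>r \<ge> 2\<close> by auto
  then have "0 < L" "L < 1"
    using q1 \<open>r \<ge> 2\<close> by (simp_all add: L_def)
  then have "L < min 1 (exp \<eta> * L)"
    using \<open>\<eta> > 0\<close> by simp
  then obtain \<mu> where \<mu>: "L < \<mu>" "\<mu> < 1" "\<mu> < exp \<eta> * L"
    using dense[of L] by (metis min_less_iff_conj)
  \<comment> \<open>Inside the disc the orbit contracts by \<open>\<mu>\<close>. The gap up to
    \<open>\<nu>\<close> absorbs the factor \<open>\<delta> / \<mu> ^ j\<close> for large
    \<open>n\<close>, and the gap from \<open>\<nu>\<close> to \<open>exp \<eta> * L\<close> lets
    \<open>q\<close> move.\<close>
  then obtain \<nu> where \<nu>: "\<mu> < \<nu>" "\<nu> < exp \<eta> * L"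
    using dense by blast
  obtain \<delta> where \<delta>: "\<delta> > 0" "\<And>q y. dist q q1 < \<delta> \<Longrightarrow> dist y 1 < \<delta> \<Longrightarrow>
       y ^ r + q - 2 \<noteq> 0 \<and> 0 < cmod (slope r q y) \<and> cmod (slope r q y) < \<mu>"
    using slope_bounds[of q1 0 r \<mu>] \<open>q1 \<noteq> 1\<close> \<open>0 < L\<close> \<mu> unfolding L_def by blast
  obtain j where j: "poly (orbit_den r j) q1 \<noteq> 0"
    "cmod (poly (orbit_num r j) q1 / poly (orbit_den r j) q1 - 1) < \<delta>"
    using orbit_enters_disc[OF \<open>r \<ge> 2\<close> q1 \<delta>(1)] .
  have ev1: "\<forall>\<^sub>F q in nhds q1. poly (orbit_den r j) q \<noteq> 0"
    by (intro tendsto_imp_eventually_ne[OF _ j(1)] isCont_tendsto_compose[OF poly_isCont] filterlim_ident)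
  have "((\<lambda>q. cmod (poly (orbit_num r j) q / poly (orbit_den r j) q - 1)) \<longlongrightarrow>
        cmod (poly (orbit_num r j) q1 / poly (orbit_den r j) q1 - 1)) (nhds q1)"
    by (intro tendsto_intros isCont_tendsto_compose[OF poly_isCont] filterlim_ident j)
  from order_tendstoD(2)[OF this j(2)]
  have ev2: "\<forall>\<^sub>F q in nhds q1. cmod (poly (orbit_num r j) q / poly (orbit_den r j) q - 1) < \<delta>" .
  have "((\<lambda>q. exp \<eta> * (r / cmod (q - 1))) \<longlongrightarrow> exp \<eta> * (r / cmod (q1 - 1))) (nhds q1)"
    by (intro tendsto_intros filterlim_ident) (use \<open>q1 \<noteq> 1\<close> in auto)
  from order_tendstoD(1)[OF this] \<nu>(2)
  have ev3: "\<forall>\<^sub>F q in nhds q1. \<nu> < exp \<eta> * (r / cmod (q - 1))"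
    by (auto simp: L_def)
  have ev4: "\<forall>\<^sub>F q in nhds q1. dist q q1 < \<delta>"
    unfolding eventually_nhds_metric using \<delta>(1) by blast
  obtain \<epsilon> where \<epsilon>: "\<epsilon> > 0" "\<And>q. dist q q1 < \<epsilon> \<Longrightarrow> poly (orbit_den r j) q \<noteq> 0 \<and>
      cmod (poly (orbit_num r j) q / poly (orbit_den r j) q - 1) < \<delta> \<and>
      \<nu> < exp \<eta> * (r / cmod (q - 1)) \<and> dist q q1 < \<delta>"
    using eventually_conj[OF ev1 eventually_conj[OF ev2 eventually_conj[OF ev3 ev4]]]
    unfolding eventually_nhds_metric by blast
  have "0 < \<mu>" "0 < \<nu>" using \<mu> \<nu> \<open>0 < L\<close> by linarith+
  have "(\<lambda>n. \<delta> / \<mu> ^ j * (\<mu> / \<nu>) ^ n) \<longlonglongrightarrow> \<delta> / \<mu> ^ j * 0"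
    by (intro tendsto_intros LIMSEQ_realpow_zero) (use \<open>0 < \<mu>\<close> \<open>0 < \<nu>\<close> \<nu> in auto)
  then have "\<forall>\<^sub>F n in sequentially. \<delta> / \<mu> ^ j * (\<mu> / \<nu>) ^ n < 1"
    by (intro order_tendstoD(2)[where y = 0]) auto
  then obtain n1 where n1: "\<And>n. n \<ge> n1 \<Longrightarrow> \<delta> / \<mu> ^ j * (\<mu> / \<nu>) ^ n < 1"
    unfolding eventually_sequentially by blast
  show thesis
  proof (rule that[OF \<epsilon>(1), of "max n1 j"])
    fix q n assume "dist q q1 < \<epsilon>" and n: "n \<ge> max n1 j"
    note q = \<epsilon>(2)[OF this(1)]
    let ?u = "\<lambda>m. poly (orbit_num r m) q / poly (orbit_den r m) q"
    have nj: "j + (n - j) = n" using n by simp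
    have "poly (orbit_den r n) q \<noteq> 0 \<and> cmod (?u n - 1) \<le> \<mu> ^ (n - j) * cmod (?u j - 1)"
      using orbit_geometric[of \<delta> r q 0 \<mu> j "n - j"] \<delta>(2) q \<mu> unfolding nj dist_norm by simp
    then have den: "poly (orbit_den r n) q \<noteq> 0"
      and "cmod (?u n - 1) \<le> \<mu> ^ (n - j) * cmod (?u j - 1)" by blast+
    note this(2)
    also have "\<mu> ^ (n - j) * cmod (?u j - 1) \<le> \<mu> ^ (n - j) * \<delta>"
      by (intro mult_left_mono) (use q \<open>0 < \<mu>\<close> in auto)
    also have "\<dots> = (\<delta> / \<mu> ^ j * (\<mu> / \<nu>) ^ n) * \<nu> ^ n"
      using n \<open>0 < \<mu>\<close> \<open>0 < \<nu>\<close> by (simp add: power_diff power_divide)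
    also have "\<dots> \<le> 1 * \<nu> ^ n"
      by (intro mult_right_mono) (use n1[of n] n \<open>0 < \<nu>\<close> in auto)
    also have "1 * \<nu> ^ n \<le> (exp \<eta> * (r / cmod (q - 1))) ^ n"
      using q \<open>0 < \<nu>\<close> by (simp del: times_divide_eq_right add: power_mono)
    finally show "poly (orbit_den r n) q \<noteq> 0 \<and> cmod (?u n - 1) \<le> (exp \<eta> * (r / cmod (q - 1))) ^ n"
      using den by blast
  qed
qed

lemma orbit_upper_compact:
  assumes "r \<ge> 2" "\<eta> > 0" "compact K" and K: "\<And>q. q \<in> K \<Longrightarrow> cmod (q - 1) > real r"
  obtains n0 where "\<And>q n. \<lbrakk>q \<in> K; n \<ge> n0\<rbrakk> \<Longrightarrow> poly (orbit_den r n) q \<noteq> 0 \<and>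
    cmod (poly (orbit_num r n) q / poly (orbit_den r n) q - 1) \<le> (exp \<eta> * (r / cmod (q - 1))) ^ n"
proof -
  let ?P = "\<lambda>q n. poly (orbit_den r n) q \<noteq> 0 \<and>
    cmod (poly (orbit_num r n) q / poly (orbit_den r n) q - 1) \<le> (exp \<eta> * (r / cmod (q - 1))) ^ n"
  have "\<exists>\<epsilon> n0. q1 \<in> K \<longrightarrow> \<epsilon> > 0 \<and> (\<forall>q n. dist q q1 < \<epsilon> \<longrightarrow> n \<ge> n0 \<longrightarrow> ?P q n)" for q1
    using orbit_upper_local[OF assms(1) K assms(2), of q1] by metis
  then obtain \<epsilon> m where \<epsilon>: "\<And>q1. q1 \<in> K \<Longrightarrow> \<epsilon> q1 > 0"
    and m: "\<And>q1 q n. \<lbrakk>q1 \<in> K; dist q q1 < \<epsilon> q1; n \<ge> m q1\<rbrakk> \<Longrightarrow> ?P q n"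
    by metis
  obtain F where F: "F \<subseteq> K" "finite F" "K \<subseteq> (\<Union>q\<in>F. ball q (\<epsilon> q))"
    using compactE_image[OF \<open>compact K\<close>, of K "\<lambda>q. ball q (\<epsilon> q)"] \<epsilon> by (metis (no_types, lifting) UN_I centre_in_ball open_ball subsetI)
  \<comment> \<open>A sum dominates each \<open>m q\<close> and, unlike a maximum, needs no separate
    case for empty \<open>F\<close>.\<close>
  show thesis
  proof (rule that[of "\<Sum>q\<in>F. m q"])
    fix q n assume "q \<in> K" "n \<ge> (\<Sum>q\<in>F. m q)"
    then obtain q1 where q1: "q1 \<in> F" "dist q q1 < \<epsilon> q1"
      using F(3) by (auto simp: dist_commute)
    have "m q1 \<le> (\<Sum>q\<in>F. m q)"
      using q1(1) F(2) by (simp add: member_le_sum)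
    then show "?P q n"
      using m[of q1 q n] F(1) q1 \<open>n \<ge> _\<close> by auto
  qed
qed

lemma orbit_tendsto_one:
  assumes "r \<ge> 2" "cmod (q - 1) > real r"
  shows "\<forall>\<^sub>F n in sequentially. poly (orbit_den r n) q \<noteq> 0"
    and "(\<lambda>n. poly (orbit_num r n) q / poly (orbit_den r n) q) \<longlonglongrightarrow> 1"
proof -
  have "q \<noteq> 1" using assms by auto
  \<comment> \<open>Half of the logarithmic rate is given away, and the other half remains as the
    decay \<open>exp (- \<eta>)\<close>.\<close>
  define \<eta> where "\<eta> = ln (cmod (q - 1) / r) / 2"
  have "\<eta> > 0"
    unfolding \<eta>_def using assms \<open>r \<ge> 2\<close> by (intro divide_pos_pos ln_gt_zero) (auto simp: field_simps)
  have "exp (2 * \<eta>) = cmod (q - 1) / r"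
    using assms \<open>q \<noteq> 1\<close> by (simp add: \<eta>_def)
  then have "exp \<eta> * (r / cmod (q - 1)) = exp \<eta> / exp (2 * \<eta>)"
    by simp
  also have "\<dots> = exp (- \<eta>)"
    by (simp flip: exp_diff)
  finally have eq: "exp \<eta> * (r / cmod (q - 1)) = exp (- \<eta>)" .
  have K: "compact {q}" "\<And>x. x \<in> {q} \<Longrightarrow> cmod (x - 1) > real r"
    using assms(2) by auto
  obtain n0 where "\<And>x n. \<lbrakk>x \<in> {q}; n \<ge> n0\<rbrakk> \<Longrightarrow> poly (orbit_den r n) x \<noteq> 0 \<and>
    cmod (poly (orbit_num r n) x / poly (orbit_den r n) x - 1) \<le> (exp \<eta> * (r / cmod (x - 1))) ^ n"
    using orbit_upper_compact[OF assms(1) \<open>\<eta> > 0\<close> K] by blast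
  from this[of q, unfolded eq] have n0: "\<And>n. n \<ge> n0 \<Longrightarrow> poly (orbit_den r n) q \<noteq> 0 \<and>
    cmod (poly (orbit_num r n) q / poly (orbit_den r n) q - 1) \<le> exp (- \<eta>) ^ n"
    by blast
  then show "\<forall>\<^sub>F n in sequentially. poly (orbit_den r n) q \<noteq> 0"
    unfolding eventually_sequentially by blast
  have "(\<lambda>n. exp (- \<eta>) ^ n) \<longlonglongrightarrow> 0"
    using \<open>\<eta> > 0\<close> by (intro LIMSEQ_realpow_zero) auto
  then have "(\<lambda>n. poly (orbit_num r n) q / poly (orbit_den r n) q - 1) \<longlonglongrightarrow> 0"
    by (rule Lim_null_comparison[rotated]) (use n0 in \<open>auto simp: eventually_sequentially\<close>)
  then show "(\<lambda>n. poly (orbit_num r n) q / poly (orbit_den r n) q) \<longlonglongrightarrow> 1"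
    by (simp add: LIM_zero_iff)
qed

text \<open>An orbit that hits \<open>1\<close> stays there, hence the hypothesis \<open>ne\<close>.
  Otherwise its distance from \<open>1\<close> on entering the disc is positive, and from then on it
  shrinks at each step by at most a factor close to the multiplier.\<close>

lemma orbit_lower:
  assumes "r \<ge> 2" and q: "cmod (q - 1) > real r" and "\<eta> > 0"
    and ne: "\<And>n. poly (orbit_num r n) q \<noteq> poly (orbit_den r n) q"
  obtains c n0 where "c > 0" "\<And>n. n \<ge> n0 \<Longrightarrow> poly (orbit_den r n) q \<noteq> 0 \<and>
    c * (exp (- \<eta>) * (r / cmod (q - 1))) ^ n \<le> cmod (poly (orbit_num r n) q / poly (orbit_den r n) q - 1)"
proof -
  define L where "L = r / cmod (q - 1)"
  define \<mu> where "\<mu> = exp (- \<eta>) * L"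
  have "q \<noteq> 1" using q \<open>r \<ge> 2\<close> by auto
  then have "0 < L" "L < 1"
    using q \<open>r \<ge> 2\<close> by (simp_all add: L_def)
  then have \<mu>: "0 < \<mu>" "\<mu> < L"
    using \<open>\<eta> > 0\<close> by (auto simp: \<mu>_def)
  obtain \<delta> where \<delta>: "\<delta> > 0" "\<And>q' y. dist q' q < \<delta> \<Longrightarrow> dist y 1 < \<delta> \<Longrightarrow>
       y ^ r + q' - 2 \<noteq> 0 \<and> \<mu> < cmod (slope r q' y) \<and> cmod (slope r q' y) < 1"
    using slope_bounds[of q \<mu> r 1] \<open>q \<noteq> 1\<close> \<open>L < 1\<close> \<mu> unfolding L_def by blast
  let ?u = "\<lambda>m. poly (orbit_num r m) q / poly (orbit_den r m) q"
  obtain j where j: "poly (orbit_den r j) q \<noteq> 0" "cmod (?u j - 1) < \<delta>"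
    using orbit_enters_disc[OF \<open>r \<ge> 2\<close> q \<delta>(1)] .
  have "?u j - 1 \<noteq> 0"
    using ne[of j] j(1) by simp
  show thesis
  proof (rule that[of "cmod (?u j - 1) / \<mu> ^ j" j])
    show "cmod (?u j - 1) / \<mu> ^ j > 0"
      using \<open>?u j - 1 \<noteq> 0\<close> \<mu> by simp
    fix n assume "n \<ge> j"
    then have nj: "j + (n - j) = n" by simp
    have "poly (orbit_den r n) q \<noteq> 0 \<and> \<mu> ^ (n - j) * cmod (?u j - 1) \<le> cmod (?u n - 1)"
      using orbit_geometric[of \<delta> r q \<mu> 1 j "n - j"] \<delta> j \<mu> unfolding nj dist_norm by simp
    moreover have "\<mu> ^ (n - j) * cmod (?u j - 1) = cmod (?u j - 1) / \<mu> ^ j * \<mu> ^ n"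
      using \<mu> \<open>n \<ge> j\<close> by (simp add: power_diff)
    ultimately show "poly (orbit_den r n) q \<noteq> 0 \<and>
       cmod (?u j - 1) / \<mu> ^ j * (exp (- \<eta>) * (r / cmod (q - 1))) ^ n \<le> cmod (?u n - 1)"
      by (simp add: \<mu>_def L_def)
  qed
qed

section \<open>Colour counting\<close>

lemma equiv_comp_rel: "equiv V (comp_rel V ends A)"
proof -
  let ?R = "{(fst (ends e), snd (ends e)) |e. e \<in> A}"
  define S where "S = (?R \<union> ?R\<inverse>)\<^sup>*"
  have S: "refl S" "trans S" "sym S"
    unfolding S_def by (intro refl_rtrancl trans_rtrancl sym_rtrancl sym_Un_converse)+
  have "refl_on V (S \<inter> V \<times> V)"
    using S(1) unfolding refl_on_def by blast
  moreover have "sym (S \<inter> V \<times> V)"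
    using S(3) unfolding sym_def by blast
  moreover have "trans (S \<inter> V \<times> V)"
    using S(2) unfolding trans_def by blast
  moreover have "comp_rel V ends A = S \<inter> V \<times> V"
    by (simp only: comp_rel_def Let_def S_def)
  ultimately show ?thesis
    by (auto simp: equiv_def)
qed

lemma comp_rel_edge:
  assumes "e \<in> A" "ends e \<in> V \<times> V"
  shows "(fst (ends e), snd (ends e)) \<in> comp_rel V ends A"
proof -
  have "(fst (ends e), snd (ends e)) \<in> {(fst (ends e), snd (ends e)) |e. e \<in> A}"
    using assms by blast
  then show ?thesis
    using assms unfolding comp_rel_def Let_def mem_Times_iff by blast
qed

lemma comp_rel_constant:
  assumes "(x, y) \<in> comp_rel V ends A" and c: "\<And>e. e \<in> A \<Longrightarrow> c (fst (ends e)) = c (snd (ends e))"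
  shows "c x = c y"
proof -
  define R where "R = {(fst (ends e), snd (ends e)) |e. e \<in> A}"
  have "(x, y) \<in> (R \<union> R\<inverse>)\<^sup>*"
    using assms(1) by (simp add: comp_rel_def Let_def R_def)
  moreover have R: "c a = c b" if ab: "(a, b) \<in> R" for a b
  proof -
    obtain e where "e \<in> A" "a = fst (ends e)" "b = snd (ends e)"
      using ab unfolding R_def by blast
    then show ?thesis using c by simp
  qed
  ultimately show ?thesis
  proof induction
    case (step y z)
    then have "c y = c z"
      using R by auto
    with step show ?case by simp
  qed simp
qed

text \<open>Such a colouring is the same as a colouring of the components; \<open>\<psi>\<close>
  reads the colour of a component off a chosen representative.\<close>

lemma card_colourings_constant_on_edges:
  fixes V :: "'v set" and K :: "'c set"
  assumes "finite V" and ends: "\<And>e. e \<in> A \<Longrightarrow> ends e \<in> V \<times> V"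
  shows "card {c \<in> V \<rightarrow>\<^sub>E K. \<forall>e\<in>A. c (fst (ends e)) = c (snd (ends e))} = card K ^ num_components V ends A"
proof -
  define R where "R = comp_rel V ends A"
  have R: "equiv V R"
    unfolding R_def by (rule equiv_comp_rel)
  define \<phi> where "\<phi> = (\<lambda>f :: 'v set \<Rightarrow> 'c. \<lambda>v\<in>V. f (R `` {v}))"
  define \<psi> where "\<psi> = (\<lambda>c :: 'v \<Rightarrow> 'c. \<lambda>X\<in>V // R. c (SOME v. v \<in> X))"
  have "bij_betw \<phi> ((V // R) \<rightarrow>\<^sub>E K) {c \<in> V \<rightarrow>\<^sub>E K. \<forall>e\<in>A. c (fst (ends e)) = c (snd (ends e))}"
  proof (rule bij_betw_byWitness[where f' = \<psi>])
    have some: "(SOME v. v \<in> X) \<in> X" if "X \<in> V // R" for X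
      using in_quotient_imp_non_empty[OF R that] by (simp add: some_in_eq)
    have cls: "X = R `` {v}" if "X \<in> V // R" "v \<in> X" for X v
    proof -
      obtain x where "X = R `` {x}" using \<open>X \<in> V // R\<close> by (rule quotientE)
      then show ?thesis using equiv_class_eq[OF R, of x v] \<open>v \<in> X\<close> by simp
    qed
    show "\<forall>f\<in>(V // R) \<rightarrow>\<^sub>E K. \<psi> (\<phi> f) = f"
    proof (intro ballI ext)
      fix f X assume f: "f \<in> (V // R) \<rightarrow>\<^sub>E K"
      show "\<psi> (\<phi> f) X = f X"
      proof (cases "X \<in> V // R")
        case True
        then have "(SOME v. v \<in> X) \<in> V"
          using some[OF True] in_quotient_imp_subset[OF R True] by blast
        with True show ?thesis
          using cls[OF True some[OF True]] by (simp add: \<phi>_def \<psi>_def)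
      qed (use f in \<open>auto simp: \<psi>_def PiE_def extensional_def\<close>)
    qed
    show "\<forall>c\<in>{c \<in> V \<rightarrow>\<^sub>E K. \<forall>e\<in>A. c (fst (ends e)) = c (snd (ends e))}.
        \<phi> (\<psi> c) = c"
    proof (intro ballI ext)
      fix c v assume c: "c \<in> {c \<in> V \<rightarrow>\<^sub>E K. \<forall>e\<in>A. c (fst (ends e)) = c (snd (ends e))}"
      show "\<phi> (\<psi> c) v = c v"
      proof (cases "v \<in> V")
        case True
        then have X: "R `` {v} \<in> V // R"
          by (rule quotientI)
        have "(v, SOME x. x \<in> R `` {v}) \<in> R"
          using some[OF X] by simp
        then have "c v = c (SOME x. x \<in> R `` {v})"
          unfolding R_def by (rule comp_rel_constant) (use c in auto)
        with True X show ?thesis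
          by (simp add: \<phi>_def \<psi>_def)
      qed (use c in \<open>auto simp: \<phi>_def PiE_def extensional_def\<close>)
    qed
    show "\<phi> ` ((V // R) \<rightarrow>\<^sub>E K) \<subseteq> {c \<in> V \<rightarrow>\<^sub>E K. \<forall>e\<in>A. c (fst (ends e)) = c (snd (ends e))}"
    proof (intro image_subsetI CollectI conjI ballI)
      fix f assume f: "f \<in> (V // R) \<rightarrow>\<^sub>E K"
      have "f (R `` {v}) \<in> K" if "v \<in> V" for v
        by (rule PiE_mem[OF f quotientI[OF that]])
      then show "\<phi> f \<in> V \<rightarrow>\<^sub>E K"
        by (simp add: \<phi>_def)
      fix e assume "e \<in> A"
      then have "(fst (ends e), snd (ends e)) \<in> R"
        unfolding R_def by (rule comp_rel_edge) (rule ends[OF \<open>e \<in> A\<close>])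
      then have "R `` {fst (ends e)} = R `` {snd (ends e)}"
        by (rule equiv_class_eq[OF R])
      then show "\<phi> f (fst (ends e)) = \<phi> f (snd (ends e))"
        using ends[OF \<open>e \<in> A\<close>] by (auto simp: \<phi>_def mem_Times_iff)
    qed
    show "\<psi> ` {c \<in> V \<rightarrow>\<^sub>E K. \<forall>e\<in>A. c (fst (ends e)) = c (snd (ends e))} \<subseteq> (V // R) \<rightarrow>\<^sub>E K"
    proof (intro image_subsetI)
      fix c assume c: "c \<in> {c \<in> V \<rightarrow>\<^sub>E K. \<forall>e\<in>A. c (fst (ends e)) = c (snd (ends e))}"
      have "c (SOME v. v \<in> X) \<in> K" if "X \<in> V // R" for X
        by (rule PiE_mem[of c V]) (use c some[OF that] in_quotient_imp_subset[OF R that] in blast)+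
      then show "\<psi> c \<in> (V // R) \<rightarrow>\<^sub>E K"
        by (simp add: \<psi>_def)
    qed
  qed
  then have "card {c \<in> V \<rightarrow>\<^sub>E K. \<forall>e\<in>A. c (fst (ends e)) = c (snd (ends e))} = card ((V // R) \<rightarrow>\<^sub>E K)"
    by (rule bij_betw_same_card[symmetric])
  also have "\<dots> = card K ^ num_components V ends A"
    using finite_quotient[OF \<open>finite V\<close>, of R] equiv_type[OF R]
    by (simp add: card_PiE num_components_def R_def)
  finally show ?thesis .
qed

lemma prod_of_bool:
  "finite A \<Longrightarrow> (\<Prod>x\<in>A. of_bool (P x) :: 'a::comm_semiring_1) = of_bool (\<forall>x\<in>A. P x)"
  by (induction A rule: finite_induct) auto

text \<open>Inclusion-exclusion: multiplying out the factors
  \<open>1 - [the ends of e agree]\<close> over all edges gives the signed sum over edge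
  subsets.\<close>

lemma poly_chromatic_poly_of_nat:
  assumes "finite V" "finite E" and ends: "\<And>e. e \<in> E \<Longrightarrow> ends e \<in> V \<times> V"
  shows "poly (chromatic_poly V E ends) (of_nat k) =
    (\<Sum>c\<in>V \<rightarrow>\<^sub>E {..<k}. \<Prod>e\<in>E. of_bool (c (fst (ends e)) \<noteq> c (snd (ends e))))"
proof -
  let ?C = "V \<rightarrow>\<^sub>E {..<k}"
  let ?eq = "\<lambda>c e. c (fst (ends e)) = c (snd (ends e))"
  have fin: "finite ?C"
    using assms by (simp add: finite_PiE)
  have comp: "(of_nat k :: complex) ^ num_components V ends A = (\<Sum>c\<in>?C. \<Prod>e\<in>A. of_bool (?eq c e))"
    if "A \<in> Pow E" for A
  proof -
    have "card {c \<in> ?C. \<forall>e\<in>A. ?eq c e} = card {..<k} ^ num_components V ends A"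
      by (rule card_colourings_constant_on_edges[OF \<open>finite V\<close>]) (use ends that in blast)
    note card_eq = this[simplified]
    have "finite A"
      using that \<open>finite E\<close> finite_subset by blast
    have "(\<Sum>c\<in>?C. \<Prod>e\<in>A. of_bool (?eq c e) :: complex) = (\<Sum>c\<in>?C. of_bool (\<forall>e\<in>A. ?eq c e))"
      by (intro sum.cong refl prod_of_bool \<open>finite A\<close>)
    also have "\<dots> = of_nat (card {c \<in> ?C. \<forall>e\<in>A. ?eq c e})"
      using fin by (subst sum_of_bool_eq) (auto intro!: arg_cong[where f = card])
    also have "\<dots> = of_nat k ^ num_components V ends A"
      by (simp only: card_eq of_nat_power)
    finally show ?thesis ..
  qed
  have "poly (chromatic_poly V E ends) (of_nat k) =
      (\<Sum>A\<in>Pow E. (-1) ^ card A * of_nat k ^ num_components V ends A)"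
    by (simp add: chromatic_poly_def poly_sum poly_monom)
  also have "\<dots> = (\<Sum>A\<in>Pow E. \<Sum>c\<in>?C. \<Prod>e\<in>A. - of_bool (?eq c e))"
    by (intro sum.cong refl) (simp add: comp sum_distrib_left prod_uminus)
  also have "\<dots> = (\<Sum>c\<in>?C. \<Sum>A\<in>Pow E. \<Prod>e\<in>A. - of_bool (?eq c e))"
    by (rule sum.swap)
  also have "\<dots> = (\<Sum>c\<in>?C. \<Prod>e\<in>E. - of_bool (?eq c e) + 1)"
    by (intro sum.cong refl) (subst prod_add[OF \<open>finite E\<close>], simp)
  also have "\<dots> = (\<Sum>c\<in>?C. \<Prod>e\<in>E. of_bool (\<not> ?eq c e))"
    by (intro sum.cong prod.cong refl) auto
  finally show ?thesis .
qed

lemma sum_PiE_Un_disjoint: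
  assumes "A \<inter> B = {}"
  shows "(\<Sum>h\<in>(A \<union> B) \<rightarrow>\<^sub>E K. F h) = (\<Sum>f\<in>A \<rightarrow>\<^sub>E K. \<Sum>g\<in>B \<rightarrow>\<^sub>E K. F (\<lambda>x. if x \<in> A then f x else g x))"
  unfolding sum.cartesian_product
proof (rule sum.reindex_bij_witness[where j = "\<lambda>h. (restrict h A, restrict h B)"
      and i = "\<lambda>(f, g) x. if x \<in> A then f x else g x"])
  show "(case (restrict h A, restrict h B) of (f, g) \<Rightarrow> \<lambda>x. if x \<in> A then f x else g x) = h"
    if "h \<in> (A \<union> B) \<rightarrow>\<^sub>E K" for h
    using that by (auto simp: fun_eq_iff PiE_def extensional_def)
  then show "(case (restrict h A, restrict h B) of (f, g) \<Rightarrow> F (\<lambda>x. if x \<in> A then f x else g x)) = F h"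
    if "h \<in> (A \<union> B) \<rightarrow>\<^sub>E K" for h
    using that by simp
  show "(restrict (case p of (f, g) \<Rightarrow> \<lambda>x. if x \<in> A then f x else g x) A,
      restrict (case p of (f, g) \<Rightarrow> \<lambda>x. if x \<in> A then f x else g x) B) = p"
    if "p \<in> (A \<rightarrow>\<^sub>E K) \<times> (B \<rightarrow>\<^sub>E K)" for p
    using that assms by (cases p) (auto simp: fun_eq_iff PiE_def extensional_def)
qed (use assms in \<open>auto simp: PiE_def extensional_def Pi_def split: if_splits\<close>)

section \<open>Proper colourings of the tree, level by level\<close>

definition words :: "nat \<Rightarrow> nat \<Rightarrow> nat list set" where
  "words r n = {xs. length xs = n \<and> set xs \<subseteq> {..<r}}"

definition words_upto :: "nat \<Rightarrow> nat \<Rightarrow> nat list set" where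
  "words_upto r n = {xs. length xs \<le> n \<and> set xs \<subseteq> {..<r}}"

lemma finite_words: "finite (words r n)"
  unfolding words_def using finite_lists_length_eq[of "{..<r}" n] by (simp add: conj_commute)

lemma finite_words_upto: "finite (words_upto r n)"
  unfolding words_upto_def using finite_lists_length_le[of "{..<r}" n] by (simp add: conj_commute)

lemma finite_leaf_tree_E: "finite (leaf_tree_E r n)"
  by (rule finite_subset[OF _ finite_words_upto[of r n]]) (auto simp: leaf_tree_E_def words_upto_def)

lemma words_upto_Suc: "words_upto r (Suc n) = words_upto r n \<union> words r (Suc n)"
  "words_upto r n \<inter> words r (Suc n) = {}"
  by (auto simp: words_upto_def words_def)

lemma leaf_tree_E_Suc: "leaf_tree_E r (Suc n) = leaf_tree_E r n \<union> words r (Suc n)"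
  "leaf_tree_E r n \<inter> words r (Suc n) = {}"
  by (auto simp: leaf_tree_E_def words_def)

lemma prod_words_Suc:
  fixes F :: "nat list \<Rightarrow> 'a::comm_monoid_mult"
  shows "(\<Prod>xs\<in>words r (Suc n). F (butlast xs)) = (\<Prod>ys\<in>words r n. F ys ^ r)"
proof -
  have "(\<Prod>ys\<in>words r n. F ys ^ r) = (\<Prod>ys\<in>words r n. \<Prod>i<r. F ys)"
    by simp
  also have "\<dots> = (\<Prod>(ys, i)\<in>words r n \<times> {..<r}. F ys)"
    by (rule prod.cartesian_product)
  also have "\<dots> = (\<Prod>xs\<in>words r (Suc n). F (butlast xs))"
  proof (rule prod.reindex_bij_witness[where j = "\<lambda>(ys, i). ys @ [i]" and i = "\<lambda>xs. (butlast xs, last xs)"])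
    fix xs assume xs: "xs \<in> words r (Suc n)"
    then have "xs \<noteq> []" by (auto simp: words_def)
    then show "(case (butlast xs, last xs) of (ys, i) \<Rightarrow> ys @ [i]) = xs" by simp
    have "last xs \<in> {..<r}"
      using xs last_in_set[OF \<open>xs \<noteq> []\<close>] unfolding words_def by blast
    then show "(butlast xs, last xs) \<in> words r n \<times> {..<r}"
      using xs by (auto simp: words_def dest: in_set_butlastD)
  qed (auto simp: words_def)
  finally show ?thesis ..
qed

text \<open>A partition function of the tree with its leaves kept apart. The weight \<open>w\<close>
  stands for everything that was attached below a leaf and has already been summed out.\<close>

definition tree_sum :: "nat \<Rightarrow> nat \<Rightarrow> (nat \<Rightarrow> complex) \<Rightarrow> nat \<Rightarrow> complex" where
  "tree_sum r k w n = (\<Sum>g\<in>words_upto r n \<rightarrow>\<^sub>E {..<k}.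
     (\<Prod>xs\<in>leaf_tree_E r n. of_bool (g (butlast xs) \<noteq> g xs)) * (\<Prod>xs\<in>words r n. w (g xs)))"

lemma tree_sum_0: "tree_sum r k w 0 = (\<Sum>b<k. w b)"
proof -
  have [simp]: "words_upto r 0 = {[]}" "words r 0 = {[]}" "leaf_tree_E r 0 = {}"
    by (auto simp: words_def words_upto_def leaf_tree_E_def)
  show ?thesis
    using prod_sum_PiE[of "{[] :: nat list}" "\<lambda>_. {..<k}" "\<lambda>_. w"] by (simp add: tree_sum_def)
qed

text \<open>Summing out the colours of the bottom level leaves a tree of smaller height with a new weight on its leaves.\<close>

lemma tree_sum_Suc:
  "tree_sum r k w (Suc n) = tree_sum r k (\<lambda>b. (\<Sum>b'\<in>{..<k} - {b}. w b') ^ r) n"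
proof -
  let ?T = "\<lambda>b. \<Sum>b'\<in>{..<k} - {b}. w b'"
  let ?mix = "\<lambda>f g x. if x \<in> words_upto r n then f x else g x"
  have up: "xs \<in> words_upto r n" "butlast xs \<in> words_upto r n" if "xs \<in> leaf_tree_E r n" for xs
    using that by (auto simp: words_upto_def leaf_tree_E_def dest: in_set_butlastD)
  have last: "xs \<notin> words_upto r n" "butlast xs \<in> words_upto r n" if "xs \<in> words r (Suc n)" for xs
    using that by (auto simp: words_upto_def words_def dest: in_set_butlastD)
  have T: "(\<Sum>b<k. of_bool (b' \<noteq> b) * w b) = ?T b'" for b'
  proof -
    have "(\<Sum>b\<in>{..<k} - {b'}. w b) = (\<Sum>b\<in>{..<k} - {b'}. of_bool (b' \<noteq> b) * w b)"
      by (intro sum.cong) auto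
    also have "\<dots> = (\<Sum>b<k. of_bool (b' \<noteq> b) * w b)"
      by (intro sum.mono_neutral_left) auto
    finally show ?thesis ..
  qed
  \<comment> \<open>Once the upper colours \<open>f\<close> are fixed, the bottom vertices are
    coloured independently, so the sum of products factorises.\<close>
  have inner: "(\<Sum>g\<in>words r (Suc n) \<rightarrow>\<^sub>E {..<k}.
      (\<Prod>xs\<in>leaf_tree_E r (Suc n). of_bool (?mix f g (butlast xs) \<noteq> ?mix f g xs)) *
      (\<Prod>xs\<in>words r (Suc n). w (?mix f g xs))) =
      (\<Prod>xs\<in>leaf_tree_E r n. of_bool (f (butlast xs) \<noteq> f xs)) * (\<Prod>xs\<in>words r n. ?T (f xs) ^ r)" for f
  proof -
    have "(\<Sum>g\<in>words r (Suc n) \<rightarrow>\<^sub>E {..<k}.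
      (\<Prod>xs\<in>leaf_tree_E r (Suc n). of_bool (?mix f g (butlast xs) \<noteq> ?mix f g xs)) *
      (\<Prod>xs\<in>words r (Suc n). w (?mix f g xs))) =
      (\<Sum>g\<in>words r (Suc n) \<rightarrow>\<^sub>E {..<k}. (\<Prod>xs\<in>leaf_tree_E r n. of_bool (f (butlast xs) \<noteq> f xs)) *
        (\<Prod>xs\<in>words r (Suc n). of_bool (f (butlast xs) \<noteq> g xs) * w (g xs)))"
    proof (intro sum.cong refl)
      fix g
      have "(\<Prod>xs\<in>leaf_tree_E r (Suc n). of_bool (?mix f g (butlast xs) \<noteq> ?mix f g xs)) =
        (\<Prod>xs\<in>leaf_tree_E r n. of_bool (f (butlast xs) \<noteq> f xs)) *
        (\<Prod>xs\<in>words r (Suc n). of_bool (f (butlast xs) \<noteq> g xs) :: complex)"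
        unfolding leaf_tree_E_Suc
        by (subst prod.union_disjoint[OF finite_leaf_tree_E finite_words leaf_tree_E_Suc(2)])
          (intro arg_cong2[where f = "(*)"] prod.cong refl; simp add: up last)
      moreover have "(\<Prod>xs\<in>words r (Suc n). w (?mix f g xs)) = (\<Prod>xs\<in>words r (Suc n). w (g xs))"
        by (intro prod.cong refl) (simp add: last)
      ultimately show "(\<Prod>xs\<in>leaf_tree_E r (Suc n). of_bool (?mix f g (butlast xs) \<noteq> ?mix f g xs)) *
          (\<Prod>xs\<in>words r (Suc n). w (?mix f g xs)) =
          (\<Prod>xs\<in>leaf_tree_E r n. of_bool (f (butlast xs) \<noteq> f xs)) *
          (\<Prod>xs\<in>words r (Suc n). of_bool (f (butlast xs) \<noteq> g xs) * w (g xs))"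
        by (simp only: prod.distrib mult.assoc)
    qed
    also have "\<dots> = (\<Prod>xs\<in>leaf_tree_E r n. of_bool (f (butlast xs) \<noteq> f xs)) *
        (\<Prod>xs\<in>words r (Suc n). \<Sum>b<k. of_bool (f (butlast xs) \<noteq> b) * w b)"
      by (subst prod_sum_PiE) (auto simp: finite_words sum_distrib_left)
    also have "\<dots> = (\<Prod>xs\<in>leaf_tree_E r n. of_bool (f (butlast xs) \<noteq> f xs)) *
        (\<Prod>xs\<in>words r (Suc n). ?T (f (butlast xs)))"
      by (simp only: T)
    also have "(\<Prod>xs\<in>words r (Suc n). ?T (f (butlast xs))) = (\<Prod>xs\<in>words r n. ?T (f xs) ^ r)"
      by (rule prod_words_Suc)
    finally show ?thesis .
  qed
  show ?thesis
    unfolding tree_sum_def words_upto_Suc(1) sum_PiE_Un_disjoint[OF words_upto_Suc(2)] inner ..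
qed

text \<open>A weight that only distinguishes \<open>b = a\<close> from \<open>b \<noteq> a\<close>
  keeps this form when a level is summed out, and the two values then change exactly by the
  recursion for \<open>orbit_num\<close> and \<open>orbit_den\<close>.\<close>

lemma tree_sum_orbit:
  assumes "a < k"
  shows "tree_sum r k (\<lambda>b. if b = a then poly (orbit_num r m) (of_nat k) ^ r
            else poly (orbit_den r m) (of_nat k) ^ r) n =
    poly (orbit_num r (m + n)) (of_nat k) ^ r + (of_nat k - 1) * poly (orbit_den r (m + n)) (of_nat k) ^ r"
proof (induction n arbitrary: m)
  case 0
  let ?s = "poly (orbit_num r m) (of_nat k) ^ r" and ?d = "poly (orbit_den r m) (of_nat k) ^ r"
  have "(\<Sum>b<k. if b = a then ?s else ?d) = ?s + (\<Sum>b\<in>{..<k} - {a}. if b = a then ?s else ?d)"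
    using assms by (subst sum.remove[of _ a]) auto
  also have "(\<Sum>b\<in>{..<k} - {a}. if b = a then ?s else ?d) = (\<Sum>b\<in>{..<k} - {a}. ?d)"
    by (intro sum.cong) auto
  finally show ?case
    using assms by (simp add: tree_sum_0 of_nat_diff)
next
  case (Suc n)
  let ?s = "poly (orbit_num r m) (of_nat k) ^ r" and ?d = "poly (orbit_den r m) (of_nat k) ^ r"
  let ?w = "\<lambda>b. if b = a then ?s else ?d"
  have T: "(\<Sum>b'\<in>{..<k} - {b}. ?w b') = (if b = a then poly (orbit_num r (Suc m)) (of_nat k)
            else poly (orbit_den r (Suc m)) (of_nat k))" if "b < k" for b
  proof (cases "b = a")
    case True
    have "(\<Sum>b'\<in>{..<k} - {b}. ?w b') = (\<Sum>b'\<in>{..<k} - {b}. ?d)"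
      using True by (intro sum.cong) auto
    then show ?thesis
      using True assms by (simp add: poly_orbit_num_Suc of_nat_diff)
  next
    case False
    have "(\<Sum>b'\<in>{..<k} - {b}. ?w b') = ?s + (\<Sum>b'\<in>{..<k} - {b} - {a}. ?w b')"
      using False assms by (subst sum.remove[of _ a]) auto
    also have "(\<Sum>b'\<in>{..<k} - {b} - {a}. ?w b') = (\<Sum>b'\<in>{..<k} - {b} - {a}. ?d)"
      by (intro sum.cong) auto
    also have "\<dots> = of_nat (k - 2) * ?d"
      using False assms that by (simp add: card_Diff_singleton numeral_2_eq_2)
    also have "of_nat (k - 2) = (of_nat k - 2 :: complex)"
      using False assms that by (subst of_nat_diff) auto
    finally show ?thesis
      using False by (simp add: poly_orbit_den_Suc)
  qed
  have "tree_sum r k ?w (Suc n) = tree_sum r k (\<lambda>b. (\<Sum>b'\<in>{..<k} - {b}. ?w b') ^ r) n"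
    by (rule tree_sum_Suc)
  also have "\<dots> = tree_sum r k (\<lambda>b. if b = a then poly (orbit_num r (Suc m)) (of_nat k) ^ r
            else poly (orbit_den r (Suc m)) (of_nat k) ^ r) n"
    unfolding tree_sum_def
  proof (intro sum.cong refl arg_cong2[where f = "(*)"] prod.cong)
    fix g xs assume "g \<in> words_upto r n \<rightarrow>\<^sub>E {..<k}" "xs \<in> words r n"
    then have "g xs < k"
      by (auto simp: PiE_iff words_def words_upto_def)
    then show "(\<Sum>b'\<in>{..<k} - {g xs}. ?w b') ^ r = (if g xs = a then poly (orbit_num r (Suc m)) (of_nat k) ^ r
            else poly (orbit_den r (Suc m)) (of_nat k) ^ r)"
      by (simp only: T split: if_splits) simp
  qed
  also have "\<dots> = poly (orbit_num r (m + Suc n)) (of_nat k) ^ r +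
      (of_nat k - 1) * poly (orbit_den r (m + Suc n)) (of_nat k) ^ r"
    using Suc.IH[of "Suc m"] by simp
  finally show ?case .
qed

lemma poly_leaf_tree_chrom_of_nat:
  assumes "r > 0"
  shows "poly (leaf_tree_chrom r (Suc n)) (of_nat k) = of_nat k *
    (poly (orbit_num r n) (of_nat k) ^ r + (of_nat k - 1) * poly (orbit_den r n) (of_nat k) ^ r)"
proof -
  let ?V = "leaf_tree_V r (Suc n)" and ?E = "leaf_tree_E r (Suc n)" and ?ends = "leaf_tree_ends (Suc n)"
  have V: "?V = insert None (Some ` words_upto r n)"
    by (auto simp: leaf_tree_V_def words_upto_def)
  have finV: "finite ?V"
    unfolding V by (simp add: finite_words_upto)
  have ends: "?ends e \<in> ?V \<times> ?V" if "e \<in> ?E" for e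
  proof -
    have "butlast e \<in> words_upto r n" "length e \<noteq> Suc n \<Longrightarrow> e \<in> words_upto r n"
      using that by (auto simp: words_upto_def leaf_tree_E_def dest: in_set_butlastD)
    then show ?thesis
      by (auto simp: V leaf_tree_ends_def)
  qed
  let ?F = "\<lambda>c. \<Prod>e\<in>?E. of_bool (c (fst (?ends e)) \<noteq> c (snd (?ends e))) :: complex"
  have chrom: "poly (leaf_tree_chrom r (Suc n)) (of_nat k) = (\<Sum>c\<in>?V \<rightarrow>\<^sub>E {..<k}. ?F c)"
    unfolding leaf_tree_chrom_def by (rule poly_chromatic_poly_of_nat[OF finV finite_leaf_tree_E ends])
  have "(case x of None \<Rightarrow> c None | Some y \<Rightarrow> (c \<circ> Some) y) = c x"
    for c :: "nat list option \<Rightarrow> nat" and x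
    by (cases x) auto
  note this [simp]
  have "(\<Sum>c\<in>?V \<rightarrow>\<^sub>E {..<k}. ?F c) = (\<Sum>(a, g)\<in>{..<k} \<times> (words_upto r n \<rightarrow>\<^sub>E {..<k}). ?F (case_option a g))"
    by (rule sum.reindex_bij_witness[where j = "\<lambda>c. (c None, c \<circ> Some)" and i = "\<lambda>(a, g). case_option a g"])
      (auto simp: V fun_eq_iff PiE_def extensional_def Pi_def split: option.splits)
  also have "\<dots> = (\<Sum>a<k. \<Sum>g\<in>words_upto r n \<rightarrow>\<^sub>E {..<k}. ?F (case_option a g))"
    by (rule sum.cartesian_product[symmetric])
  \<comment> \<open>Here \<open>a\<close> is the colour of the joined leaf. A word of length
    \<open>n\<close> has \<open>r\<close> parallel edges to it, so its colour has weight
    \<open>0\<close> if it equals \<open>a\<close> and \<open>1\<close> otherwise. These are the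
    \<open>r\<close>-th powers of the pair at index \<open>0\<close>, and the remaining tree has
    height \<open>n\<close> instead of \<open>Suc n\<close>.\<close>
  also have "\<dots> = (\<Sum>a<k. tree_sum r k (\<lambda>b. if b = a then poly (orbit_num r 0) (of_nat k) ^ r
            else poly (orbit_den r 0) (of_nat k) ^ r) n)"
    unfolding tree_sum_def
  proof (intro sum.cong refl)
    fix a g
    have "?F (case_option a g) = (\<Prod>xs\<in>leaf_tree_E r n. of_bool (g (butlast xs) \<noteq> g xs)) *
      (\<Prod>xs\<in>words r (Suc n). of_bool (g (butlast xs) \<noteq> a))"
      unfolding leaf_tree_E_Suc
      by (subst prod.union_disjoint[OF finite_leaf_tree_E finite_words leaf_tree_E_Suc(2)])
        (intro arg_cong2[where f = "(*)"] prod.cong refl; simp add: leaf_tree_ends_def words_def leaf_tree_E_def)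
    also have "(\<Prod>xs\<in>words r (Suc n). of_bool (g (butlast xs) \<noteq> a) :: complex) =
        (\<Prod>xs\<in>words r n. of_bool (g xs \<noteq> a) ^ r)"
      by (rule prod_words_Suc)
    also have "\<dots> = (\<Prod>xs\<in>words r n. if g xs = a then poly (orbit_num r 0) (of_nat k) ^ r
            else poly (orbit_den r 0) (of_nat k) ^ r)"
      using \<open>r > 0\<close> by (intro prod.cong refl) auto
    finally show "?F (case_option a g) = (\<Prod>xs\<in>leaf_tree_E r n. of_bool (g (butlast xs) \<noteq> g xs)) * \<dots>" .
  qed
  also have "\<dots> = (\<Sum>a<k. poly (orbit_num r n) (of_nat k) ^ r +
      (of_nat k - 1) * poly (orbit_den r n) (of_nat k) ^ r)"
    by (intro sum.cong refl) (use tree_sum_orbit[of _ k r 0 n] in simp)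
  finally show ?thesis by (simp add: chrom)
qed

text \<open>Two polynomials that agree at all natural numbers coincide.\<close>

lemma poly_leaf_tree_chrom:
  assumes "r > 0"
  shows "poly (leaf_tree_chrom r (Suc n)) q = q * (poly (orbit_num r n) q ^ r + (q - 1) * poly (orbit_den r n) q ^ r)"
proof -
  define p where "p = leaf_tree_chrom r (Suc n) - [:0, 1:] * (orbit_num r n ^ r + [:-1, 1:] * orbit_den r n ^ r)"
  have "poly p (of_nat k) = 0" for k
    by (simp add: p_def poly_leaf_tree_chrom_of_nat[OF assms] algebra_simps)
  then have "range of_nat \<subseteq> {x. poly p x = 0}"
    by auto
  moreover have "infinite (range of_nat :: complex set)"
    by (intro range_inj_infinite inj_of_nat)
  ultimately have "infinite {x. poly p x = 0}"
    using infinite_super by blast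
  then have "p = 0"
    using poly_roots_finite by blast
  then have "poly p q = 0" by simp
  then show ?thesis
    by (simp add: p_def algebra_simps)
qed

section \<open>Roots near the circle\<close>

text \<open>Such a \<open>\<gamma>\<close> is a second preimage of \<open>1 - q\<close>, the value of the quotient \<open>S / D\<close> at which the
chromatic polynomial vanishes.\<close>

lemma chrom_root_of_orbit:
  assumes "r > 0" "q \<noteq> 1" "\<kappa> ^ r = 1 - q" "\<gamma> ^ r = (q - 1) / \<kappa> - (q - 2)"
    and N: "poly (orbit_num r m) q = \<gamma> * poly (orbit_den r m) q"
  shows "poly (leaf_tree_chrom r (Suc (Suc m))) q = 0"
proof -
  have "\<kappa> \<noteq> 0"
    using assms by (metis power_0_left eq_iff_diff_eq_0 less_numeral_extra(3))
  have "poly (orbit_den r (Suc m)) q = (\<gamma> ^ r + (q - 2)) * poly (orbit_den r m) q ^ r"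
    by (simp add: poly_orbit_den_Suc N power_mult_distrib algebra_simps)
  also have "\<dots> = (q - 1) / \<kappa> * poly (orbit_den r m) q ^ r"
    by (simp add: assms)
  finally have "poly (orbit_num r (Suc m)) q = \<kappa> * poly (orbit_den r (Suc m)) q"
    using \<open>\<kappa> \<noteq> 0\<close> by (simp add: poly_orbit_num_Suc)
  then have "poly (orbit_num r (Suc m)) q ^ r = (1 - q) * poly (orbit_den r (Suc m)) q ^ r"
    by (simp only: power_mult_distrib assms(3))
  then show ?thesis
    using assms(1) by (simp add: poly_leaf_tree_chrom algebra_simps)
qed

text \<open>The parametrisation by \<open>\<xi>\<close> turns the circle into the imaginary axis and its exterior into the
right half plane.\<close>

lemma omitted_functions:
  assumes "r \<ge> 2" and q1: "cmod (q1 - 1) = real r" and gen: "(1 - q1) * (q1 - 2) ^ r \<noteq> (q1 - 1) ^ r"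
    and U: "open U" "q1 \<in> U"
    and Q_def: "Q = (\<lambda>\<xi>. 1 + (q1 - 1) * exp \<xi>)"
  obtains \<rho> \<alpha> \<beta> \<delta> where "\<rho> > 0" "\<And>\<xi>. \<xi> \<in> ball 0 \<rho> \<Longrightarrow> Q \<xi> \<in> U"
    "\<alpha> holomorphic_on ball 0 \<rho>" "\<beta> holomorphic_on ball 0 \<rho>" "\<delta> holomorphic_on ball 0 \<rho>"
    "\<And>\<xi>. \<xi> \<in> ball 0 \<rho> \<Longrightarrow> \<alpha> \<xi> \<noteq> \<beta> \<xi> \<and> \<alpha> \<xi> \<noteq> \<delta> \<xi> \<and> \<beta> \<xi> \<noteq> \<delta> \<xi> \<and> \<delta> \<xi> \<noteq> 1"
    "\<And>\<xi> m \<gamma>. \<lbrakk>\<xi> \<in> ball 0 \<rho>; \<gamma> \<in> {\<alpha> \<xi>, \<beta> \<xi>, \<delta> \<xi>};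
        poly (orbit_num r m) (Q \<xi>) = \<gamma> * poly (orbit_den r m) (Q \<xi>)\<rbrakk>
       \<Longrightarrow> poly (leaf_tree_chrom r (Suc (Suc m))) (Q \<xi>) = 0"
proof -
  have r0: "r > 0" and "r \<noteq> 0" using \<open>r \<ge> 2\<close> by auto
  have "q1 \<noteq> 1" using q1 \<open>r \<ge> 2\<close> by auto
  define \<zeta> where "\<zeta> = cis (2 * pi / r)"
  have "\<zeta> ^ r = 1"
    unfolding \<zeta>_def Complex.DeMoivre using r0 by simp
  have "\<zeta> \<noteq> 1"
  proof
    assume "\<zeta> = 1"
    then have "cos (2 * pi / r) = 1"
      by (simp add: \<zeta>_def complex_eq_iff)
    moreover have "cos (2 * pi / r) < cos 0"
      using \<open>r \<ge> 2\<close> by (intro cos_monotone_0_pi) (auto simp: field_simps)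
    ultimately show False by simp
  qed
  have "\<zeta> \<noteq> 0" by (simp add: \<zeta>_def)
  have root: "\<exists>w. w ^ r = z" for z :: complex
    using exists_complex_root[OF \<open>r \<noteq> 0\<close>] by metis
  obtain \<kappa>1 where \<kappa>1: "\<kappa>1 ^ r = 1 - q1"
    using root by blast
  have "\<kappa>1 \<noteq> 0"
    using \<kappa>1 \<open>q1 \<noteq> 1\<close> r0 by (auto simp: power_0_left)
  define k where "k = (\<lambda>\<xi>. \<kappa>1 * exp (\<xi> / of_nat r :: complex))"
  have k0: "k \<xi> \<noteq> 0" for \<xi>
    using \<open>\<kappa>1 \<noteq> 0\<close> by (simp add: k_def)
  have kr: "k \<xi> ^ r = 1 - Q \<xi>" for \<xi>
  proof -
    have "k \<xi> ^ r = \<kappa>1 ^ r * exp (of_nat r * (\<xi> / of_nat r))"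
      by (simp only: k_def power_mult_distrib exp_of_nat_mult)
    then show ?thesis
      using r0 by (simp add: \<kappa>1 Q_def algebra_simps)
  qed
  have Q1: "Q \<xi> \<noteq> 1" for \<xi>
    using \<open>q1 \<noteq> 1\<close> by (simp add: Q_def)
  \<comment> \<open>The radicand for second preimages lying over the first preimage
    \<open>c * k \<xi>\<close>. Below, \<open>\<alpha>\<close> and \<open>\<zeta> * \<alpha>\<close>
    lie over \<open>k\<close>, and \<open>\<beta>\<close> lies over
    \<open>\<zeta> * k\<close>.\<close>
  define A where "A = (\<lambda>c \<xi>. (Q \<xi> - 1) / (c * k \<xi>) - (Q \<xi> - 2))"
  \<comment> \<open>Taking the \<open>r\<close>-th power of the vanishing condition removes
    \<open>c\<close>, so the single condition \<open>gen\<close> serves all roots of unity.\<close>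
  have A0: "A c 0 \<noteq> 0" if c: "c ^ r = 1" for c
  proof
    have "c \<noteq> 0" using c r0 by (auto simp: power_0_left)
    assume "A c 0 = 0"
    then have "q1 - 1 = c * \<kappa>1 * (q1 - 2)"
      using \<open>c \<noteq> 0\<close> \<open>\<kappa>1 \<noteq> 0\<close> by (simp add: A_def Q_def k_def field_simps)
    then have "(q1 - 1) ^ r = (1 - q1) * (q1 - 2) ^ r"
      by (simp add: power_mult_distrib c \<kappa>1)
    with gen show False by simp
  qed
  have contQ: "isCont Q 0" and contA: "isCont (A 1) 0" "isCont (A \<zeta>) 0"
    unfolding A_def Q_def k_def by (intro continuous_intros; use \<open>\<kappa>1 \<noteq> 0\<close> \<open>\<zeta> \<noteq> 0\<close> r0 in simp)+
  have Q0: "Q 0 = q1" by (simp add: Q_def)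
  have ev: "\<forall>\<^sub>F \<xi> in nhds 0. A 1 \<xi> \<noteq> 0" "\<forall>\<^sub>F \<xi> in nhds 0. A \<zeta> \<xi> \<noteq> 0"
    using contA A0[of 1] A0[OF \<open>\<zeta> ^ r = 1\<close>]
    by (auto intro!: tendsto_imp_eventually_ne simp: isCont_def tendsto_nhds_iff)
  have tQ: "(Q \<longlongrightarrow> q1) (nhds 0)"
    using contQ Q0 by (simp add: isCont_def tendsto_nhds_iff)
  have evU: "\<forall>\<^sub>F \<xi> in nhds 0. Q \<xi> \<in> U"
    using topological_tendstoD[OF tQ U] .
  have "((\<lambda>\<xi>. cmod (Q \<xi> - 1)) \<longlongrightarrow> cmod (q1 - 1)) (nhds 0)"
    by (intro tendsto_intros tQ)
  \<comment> \<open>This excludes \<open>Q \<xi> = 0\<close>, the only value where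
    \<open>k \<xi>\<close> could be \<open>1\<close>. Hence no preimage over \<open>k \<xi>\<close>
    equals the fixed point \<open>1\<close>.\<close>
  from order_tendstoD(1)[OF this, of 1] have ev1: "\<forall>\<^sub>F \<xi> in nhds 0. 1 < cmod (Q \<xi> - 1)"
    using q1 \<open>r \<ge> 2\<close> by simp
  obtain \<rho> where \<rho>: "\<rho> > 0" "\<And>\<xi>. dist \<xi> 0 < \<rho> \<Longrightarrow> A 1 \<xi> \<noteq> 0 \<and> A \<zeta> \<xi> \<noteq> 0 \<and> Q \<xi> \<in> U \<and> 1 < cmod (Q \<xi> - 1)"
    using eventually_conj[OF ev(1) eventually_conj[OF ev(2) eventually_conj[OF evU ev1]]]
    unfolding eventually_nhds_metric by blast
  have nbhd: "A 1 \<xi> \<noteq> 0" "A \<zeta> \<xi> \<noteq> 0" "Q \<xi> \<in> U" "1 < cmod (Q \<xi> - 1)" if "\<xi> \<in> ball 0 \<rho>" for \<xi>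
    using \<rho>(2)[of \<xi>] that by (auto simp: dist_commute)
  have holA: "A c holomorphic_on ball 0 \<rho>" if "c \<noteq> 0" for c
    unfolding A_def Q_def k_def by (intro holomorphic_intros) (use \<open>\<kappa>1 \<noteq> 0\<close> r0 that in auto)
  obtain w where "w ^ r = A 1 0" using root by blast
  then obtain \<alpha> where \<alpha>: "\<alpha> holomorphic_on ball 0 \<rho>" "\<And>\<xi>. \<xi> \<in> ball 0 \<rho> \<Longrightarrow> \<alpha> \<xi> ^ r = A 1 \<xi>"
    using holomorphic_nth_root_exists[OF holA[of 1] _ _ nbhd(1) r0, where c = 0 and w = w] \<rho>(1) by auto
  obtain w where "w ^ r = A \<zeta> 0" using root by blast
  then obtain \<beta> where \<beta>: "\<beta> holomorphic_on ball 0 \<rho>" "\<And>\<xi>. \<xi> \<in> ball 0 \<rho> \<Longrightarrow> \<beta> \<xi> ^ r = A \<zeta> \<xi>"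
    using holomorphic_nth_root_exists[OF holA[of \<zeta>] _ _ nbhd(2) r0, where c = 0 and w = w] \<rho>(1) \<open>\<zeta> \<noteq> 0\<close> by auto
  have ne: "A 1 \<xi> \<noteq> A \<zeta> \<xi>" "A 1 \<xi> \<noteq> 1" if \<xi>: "\<xi> \<in> ball 0 \<rho>" for \<xi>
  proof -
    have "A 1 \<xi> - A \<zeta> \<xi> = (Q \<xi> - 1) / k \<xi> * ((\<zeta> - 1) / \<zeta>)"
      using \<open>\<zeta> \<noteq> 0\<close> k0[of \<xi>] by (simp add: A_def field_simps)
    then show "A 1 \<xi> \<noteq> A \<zeta> \<xi>"
      using Q1[of \<xi>] k0[of \<xi>] \<open>\<zeta> \<noteq> 0\<close> \<open>\<zeta> \<noteq> 1\<close> by auto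
    show "A 1 \<xi> \<noteq> 1"
    proof
      assume "A 1 \<xi> = 1"
      then have "(Q \<xi> - 1) / k \<xi> = Q \<xi> - 1"
        by (simp add: A_def algebra_simps)
      then have "k \<xi> = 1"
        using Q1[of \<xi>] k0[of \<xi>] by (simp add: divide_eq_eq)
      then have "Q \<xi> = 0"
        using kr[of \<xi>] by simp
      with nbhd(4)[OF \<xi>] show False by simp
    qed
  qed
  show thesis
  proof (rule that[of \<rho> \<alpha> \<beta> "\<lambda>\<xi>. \<zeta> * \<alpha> \<xi>"])
    fix \<xi> :: complex assume \<xi>: "\<xi> \<in> ball 0 \<rho>"
    have r1: "(\<zeta> * \<alpha> \<xi>) ^ r = A 1 \<xi>"
      using \<alpha>(2)[OF \<xi>] \<open>\<zeta> ^ r = 1\<close> by (simp add: power_mult_distrib)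
    have "\<alpha> \<xi> \<noteq> 0"
      using \<alpha>(2)[OF \<xi>] nbhd(1)[OF \<xi>] r0 by (auto simp: power_0_left)
    then have "\<alpha> \<xi> \<noteq> \<zeta> * \<alpha> \<xi>"
      using \<open>\<zeta> \<noteq> 1\<close> by simp
    moreover have "\<alpha> \<xi> \<noteq> \<beta> \<xi>" "\<beta> \<xi> \<noteq> \<zeta> * \<alpha> \<xi>"
      using \<alpha>(2)[OF \<xi>] \<beta>(2)[OF \<xi>] r1 ne(1)[OF \<xi>] by metis+
    moreover have "\<zeta> * \<alpha> \<xi> \<noteq> 1"
      using r1 ne(2)[OF \<xi>] by (metis power_one)
    ultimately show "\<alpha> \<xi> \<noteq> \<beta> \<xi> \<and> \<alpha> \<xi> \<noteq> \<zeta> * \<alpha> \<xi> \<and> \<beta> \<xi> \<noteq> \<zeta> * \<alpha> \<xi> \<and> \<zeta> * \<alpha> \<xi> \<noteq> 1"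
      by blast
    fix m \<gamma> assume \<gamma>: "\<gamma> \<in> {\<alpha> \<xi>, \<beta> \<xi>, \<zeta> * \<alpha> \<xi>}"
      and N: "poly (orbit_num r m) (Q \<xi>) = \<gamma> * poly (orbit_den r m) (Q \<xi>)"
    have "\<gamma> ^ r = A 1 \<xi> \<or> \<gamma> ^ r = A \<zeta> \<xi>"
      using \<gamma> \<alpha>(2)[OF \<xi>] \<beta>(2)[OF \<xi>] r1 by blast
    then obtain c where c: "c ^ r = 1" "\<gamma> ^ r = A c \<xi>"
      using \<open>\<zeta> ^ r = 1\<close> power_one by blast
    show "poly (leaf_tree_chrom r (Suc (Suc m))) (Q \<xi>) = 0"
      by (rule chrom_root_of_orbit[OF r0 Q1 _ _ N, of "c * k \<xi>"])
        (use c kr[of \<xi>] in \<open>simp_all add: power_mult_distrib A_def\<close>)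
  qed (use \<rho> \<alpha> \<beta> nbhd in \<open>auto intro!: holomorphic_intros\<close>)
qed

text \<open>In the right half plane \<open>H n\<close> decays like \<open>exp (- n Re \<xi>)\<close>, so a harmonic continuation of
this rate would make it grow in the left half plane, where it is only known to be bounded. The weight
\<open>exp (n (\<xi> / 2 + \<xi>\<^sup>2 / (4 s)))\<close> is chosen such that the boundary values on \<open>|\<xi>| = s\<close> are at most
\<open>exp (- n s / 4)\<close> up to small errors, while the value at \<open>x\<close> is at least \<open>exp (- n s / 8)\<close>.\<close>

lemma two_rate_contradiction:
  fixes H :: "nat \<Rightarrow> complex \<Rightarrow> complex"
  assumes "s > 0" "infinite I" and x: "0 < x" "x \<le> s / 4"
    and hol: "\<And>n. n \<in> I \<Longrightarrow> H n holomorphic_on cball 0 s"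
    and bound: "\<And>n \<xi>. n \<in> I \<Longrightarrow> norm \<xi> = s \<Longrightarrow> norm (H n \<xi>) \<le> C"
    and upper: "\<And>\<eta>. \<eta> > 0 \<Longrightarrow> \<exists>n0. \<forall>n\<ge>n0. \<forall>\<xi>. n \<in> I \<longrightarrow> norm \<xi> = s \<longrightarrow> Re \<xi> \<ge> \<eta> \<longrightarrow>
        norm (H n \<xi>) \<le> C * exp (n * (\<eta> - Re \<xi>))"
    and lower: "\<And>\<eta>. \<eta> > 0 \<Longrightarrow> \<exists>c>0. \<exists>n0. \<forall>n\<ge>n0. n \<in> I \<longrightarrow> norm (H n (of_real x)) \<ge> c * exp (- (n * (x + \<eta>)))"
  shows False
proof -
  \<comment> \<open>The exponents \<open>- s / 4 + \<eta>\<close> on the boundary and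
    \<open>- s / 8 - \<eta>\<close> at \<open>x\<close> then still differ by
    \<open>s / 16\<close>.\<close>
  define \<eta> where "\<eta> = s / 32"
  have "\<eta> > 0" using \<open>s > 0\<close> by (simp add: \<eta>_def)
  obtain n1 where n1: "\<And>n \<xi>. \<lbrakk>n \<ge> n1; n \<in> I; norm \<xi> = s; Re \<xi> \<ge> \<eta>\<rbrakk> \<Longrightarrow> norm (H n \<xi>) \<le> C * exp (n * (\<eta> - Re \<xi>))"
    using upper[OF \<open>\<eta> > 0\<close>] by blast
  obtain c n2 where "c > 0" and n2: "\<And>n. \<lbrakk>n \<ge> n2; n \<in> I\<rbrakk> \<Longrightarrow> norm (H n (of_real x)) \<ge> c * exp (- (n * (x + \<eta>)))"
    using lower[OF \<open>\<eta> > 0\<close>] by blast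
  have "(\<lambda>n. C * exp (- (s / 16)) ^ n) \<longlonglongrightarrow> C * 0"
    using \<open>s > 0\<close> by (intro tendsto_intros LIMSEQ_realpow_zero) auto
  then have "\<forall>\<^sub>F n in sequentially. C * exp (- (s / 16)) ^ n < c"
    using \<open>c > 0\<close> by (intro order_tendstoD(2)) auto
  then obtain n3 where n3: "\<And>n. n \<ge> n3 \<Longrightarrow> C * exp (- (s / 16)) ^ n < c"
    unfolding eventually_sequentially by blast
  obtain n where n: "n \<in> I" "n \<ge> n1" "n \<ge> n2" "n \<ge> n3"
    using \<open>infinite I\<close> unfolding infinite_nat_iff_unbounded_le by (metis max.bounded_iff)
  have "0 \<le> C"
    using order_trans[OF norm_ge_zero bound[OF n(1), of "of_real s"]] \<open>s > 0\<close> by simp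
  have Re_nat: "Re (of_nat n * z) = n * Re z" for z
    by simp
  define \<Psi> where "\<Psi> = (\<lambda>\<xi>. H n \<xi> * exp (of_nat n * (\<xi> / 2 + \<xi>\<^sup>2 / of_real (4 * s))))"
  have hol\<Psi>: "\<Psi> holomorphic_on cball 0 s"
    unfolding \<Psi>_def by (intro holomorphic_intros hol n) (use \<open>s > 0\<close> in auto)
  have "norm (\<Psi> (of_real x)) \<le> C * exp (n * (\<eta> - s / 4))"
  proof (rule maximum_modulus_frontier[of \<Psi> "cball 0 s"])
    show "\<Psi> holomorphic_on interior (cball 0 s)"
      using hol\<Psi> by (rule holomorphic_on_subset) (simp add: interior_subset)
    show "continuous_on (closure (cball 0 s)) \<Psi>"
      using hol\<Psi> by (simp add: holomorphic_on_imp_continuous_on)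
    show "complex_of_real x \<in> cball 0 s"
      using x \<open>s > 0\<close> by simp
    fix \<xi> assume "\<xi> \<in> frontier (cball (0::complex) s)"
    then have \<xi>: "norm \<xi> = s" using \<open>s > 0\<close> by simp
    define y where "y = Re \<xi>"
    have ys: "\<bar>y\<bar> \<le> s"
      using abs_Re_le_cmod[of \<xi>] \<xi> by (simp add: y_def)
    have "(Re \<xi>)\<^sup>2 + (Im \<xi>)\<^sup>2 = s\<^sup>2"
      using \<xi> by (simp flip: cmod_power2)
    then have re2: "Re (\<xi>\<^sup>2) = 2 * y\<^sup>2 - s\<^sup>2"
      by (simp add: y_def power2_eq_square)
    have "Re (\<xi>\<^sup>2 / of_real (4 * s)) = (2 * y\<^sup>2 - s\<^sup>2) / (4 * s)"
      unfolding re2[symmetric] by (rule Re_divide_of_real)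
    then have "Re (\<xi> / 2 + \<xi>\<^sup>2 / of_real (4 * s)) = y / 2 + (2 * y\<^sup>2 - s\<^sup>2) / (4 * s)"
      by (simp add: y_def)
    also have "\<dots> = y / 2 + y\<^sup>2 / (2 * s) - s / 4"
      using \<open>s > 0\<close> by (simp add: field_simps power2_eq_square)
    finally have norm\<Psi>: "norm (\<Psi> \<xi>) = norm (H n \<xi>) * exp (n * (y / 2 + y\<^sup>2 / (2 * s) - s / 4))"
      unfolding \<Psi>_def norm_mult norm_exp_eq_Re by (simp only: Re_nat)
    \<comment> \<open>In either half plane this removes the quadratic term:
      \<open>- y / 2 + \<bar>y\<bar> / 2\<close> vanishes for \<open>y \<ge> \<eta>\<close>, and
      \<open>y / 2 + \<bar>y\<bar> / 2\<close> is at most \<open>\<eta>\<close> for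
      \<open>y < \<eta>\<close>.\<close>
    have y2: "y\<^sup>2 / (2 * s) \<le> \<bar>y\<bar> / 2"
    proof -
      have "y\<^sup>2 \<le> \<bar>y\<bar> * s"
        using ys mult_left_mono[of "\<bar>y\<bar>" s "\<bar>y\<bar>"] by (simp add: power2_eq_square)
      then show ?thesis
        using \<open>s > 0\<close> by (simp add: field_simps)
    qed
    show "norm (\<Psi> \<xi>) \<le> C * exp (n * (\<eta> - s / 4))"
    proof (cases "y \<ge> \<eta>")
      case True
      have "norm (\<Psi> \<xi>) \<le> C * exp (n * (\<eta> - y)) * exp (n * (y / 2 + y\<^sup>2 / (2 * s) - s / 4))"
        unfolding norm\<Psi> by (intro mult_right_mono) (use n1[of n \<xi>] n \<xi> True in \<open>auto simp: y_def\<close>)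
      also have "\<dots> = C * exp (n * (\<eta> - y / 2 + y\<^sup>2 / (2 * s) - s / 4))"
        by (simp add: mult.assoc exp_add[symmetric] algebra_simps)
      also have "\<dots> \<le> C * exp (n * (\<eta> - s / 4))"
        using y2 True \<open>\<eta> > 0\<close> \<open>0 \<le> C\<close> by (intro mult_left_mono iffD2[OF exp_le_cancel_iff]) auto
      finally show ?thesis .
    next
      case False
      have "norm (\<Psi> \<xi>) \<le> C * exp (n * (y / 2 + y\<^sup>2 / (2 * s) - s / 4))"
        unfolding norm\<Psi> by (intro mult_right_mono) (use bound[of n \<xi>] n \<xi> in auto)
      also have "\<dots> \<le> C * exp (n * (\<eta> - s / 4))"
        using y2 False \<open>\<eta> > 0\<close> \<open>0 \<le> C\<close> by (intro mult_left_mono iffD2[OF exp_le_cancel_iff]) auto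
      finally show ?thesis .
    qed
  qed simp
  moreover have "norm (\<Psi> (of_real x)) \<ge> c * exp (- (n * (s / 8 + \<eta>)))"
  proof -
    have "of_real x / 2 + (of_real x)\<^sup>2 / of_real (4 * s) = complex_of_real (x / 2 + x\<^sup>2 / (4 * s))"
      by simp
    then have norm\<Psi>: "norm (\<Psi> (of_real x)) = norm (H n (of_real x)) * exp (n * (x / 2 + x\<^sup>2 / (4 * s)))"
      unfolding \<Psi>_def norm_mult norm_exp_eq_Re by (simp only: Re_nat Re_complex_of_real)
    have "c * exp (- (n * (s / 8 + \<eta>))) \<le> c * exp (- (n * (x + \<eta>)) + n * (x / 2 + x\<^sup>2 / (4 * s)))"
    proof (intro mult_left_mono iffD2[OF exp_le_cancel_iff])
      \<comment> \<open>The quadratic term only helps and is dropped; \<open>x \<le> s / 4\<close>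
        bounds the remaining \<open>x / 2\<close> by \<open>s / 8\<close>.\<close>
      have "0 \<le> x\<^sup>2 / (4 * s)" using \<open>s > 0\<close> by simp
      then have "- (s / 8 + \<eta>) \<le> - (x + \<eta>) + (x / 2 + x\<^sup>2 / (4 * s))"
        using x by linarith
      from mult_left_mono[OF this, of n]
      show "- (n * (s / 8 + \<eta>)) \<le> - (n * (x + \<eta>)) + n * (x / 2 + x\<^sup>2 / (4 * s))"
        by (simp only: distrib_left mult_minus_right of_nat_0_le_iff)
    qed (use \<open>c > 0\<close> in simp)
    also have "\<dots> = c * exp (- (n * (x + \<eta>))) * exp (n * (x / 2 + x\<^sup>2 / (4 * s)))"
      by (simp only: exp_add mult.assoc)
    also have "\<dots> \<le> norm (\<Psi> (of_real x))"
      unfolding norm\<Psi> by (intro mult_right_mono n2 n) auto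
    finally show ?thesis .
  qed
  ultimately have "c * exp (- (n * (s / 8 + \<eta>))) \<le> C * exp (n * (\<eta> - s / 4))"
    by linarith
  then have "c * exp (- (n * (s / 8 + \<eta>))) * exp (n * (s / 8 + \<eta>)) \<le>
      C * exp (n * (\<eta> - s / 4)) * exp (n * (s / 8 + \<eta>))"
    by (rule mult_right_mono) simp
  then have "c \<le> C * exp (n * (\<eta> - s / 4) + n * (s / 8 + \<eta>))"
    by (simp add: mult.assoc flip: exp_add)
  also have "n * (\<eta> - s / 4) + n * (s / 8 + \<eta>) = n * (- (s / 16))"
    by (simp add: \<eta>_def field_simps)
  also have "exp (n * (- (s / 16))) = exp (- (s / 16)) ^ n"
    by (rule exp_of_nat_mult)
  finally show False
    using n3[OF n(4)] by linarith
qed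

text \<open>Each index excludes only finitely many points of the ray, hence all of them together
  only countably many.\<close>

lemma orbit_generic_on_ray:
  assumes "r > 0" "c \<noteq> 0" "s > 0"
  obtains x where "0 < x" "x < s"
    "\<And>n. poly (orbit_num r n) (1 + c * exp (complex_of_real x)) \<noteq> poly (orbit_den r n) (1 + c * exp (complex_of_real x))"
proof -
  define h where "h = (\<lambda>x. 1 + c * exp (complex_of_real x))"
  define Z where "Z = (\<lambda>n. {q. poly (orbit_num r n - orbit_den r n) q = 0})"
  \<comment> \<open>At \<open>q = 2\<close> the orbit alternates between \<open>0\<close> and
    infinity, so \<open>orbit_num - orbit_den\<close> is never the zero polynomial.\<close>
  have at2: "poly (orbit_num r n) 2 \<noteq> poly (orbit_den r n) 2" for n
  proof -
    have "{poly (orbit_num r n) 2, poly (orbit_den r n) 2} = {0, 1}"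
      using \<open>r > 0\<close> by (induction n) (auto simp: poly_orbit_num_Suc poly_orbit_den_Suc doubleton_eq_iff power_0_left)
    then show ?thesis by (auto simp: doubleton_eq_iff)
  qed
  have "finite (Z n)" for n
    unfolding Z_def using at2[of n] by (intro poly_roots_finite) auto
  moreover have "inj h"
    using \<open>c \<noteq> 0\<close> by (auto simp: inj_def h_def exp_of_real)
  ultimately have "countable (\<Union>n. h -` Z n)"
    by (intro countable_UN) (auto intro!: countable_finite finite_vimageI)
  moreover have "uncountable {0<..<s}"
    using \<open>s > 0\<close> by (simp add: uncountable_open_interval)
  ultimately have "{0<..<s} - (\<Union>n. h -` Z n) \<noteq> {}"
    using uncountable_minus_countable by (metis countable_empty)
  then obtain x where "x \<in> {0<..<s}" "x \<notin> (\<Union>n. h -` Z n)"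
    by blast
  then show thesis
    using that[of x] by (auto simp: Z_def h_def)
qed

text \<open>The exceptional points are the zeros of a polynomial with value \<open>-1\<close> at
  \<open>2\<close>, hence finitely many, while the circle has no isolated points.\<close>

lemma generic_point_on_circle:
  assumes "r \<ge> 2" and q0: "cmod (q0 - 1) = real r" and "\<epsilon> > 0"
  obtains q1 where "cmod (q1 - 1) = real r" "dist q0 q1 < \<epsilon>" "(1 - q1) * (q1 - 2) ^ r \<noteq> (q1 - 1) ^ r"
proof -
  define p where "p = [:1, -1:] * [:-2, 1:] ^ r - [:-1, 1::complex:] ^ r"
  have p: "poly p q = (1 - q) * (q - 2) ^ r - (q - 1) ^ r" for q
    by (simp add: p_def algebra_simps)
  have "poly p 2 \<noteq> 0"
    using \<open>r \<ge> 2\<close> unfolding p by (simp add: power_0_left)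
  then have fin: "finite {q. poly p q = 0}"
    by (intro poly_roots_finite) auto
  let ?S = "sphere (1::complex) r"
  have "q0 \<in> ?S"
    using q0 by (simp add: dist_norm norm_minus_commute)
  have "1 + of_nat r \<in> ?S" "1 - of_nat r \<in> ?S"
    by (simp_all add: dist_norm)
  moreover have "1 + of_nat r \<noteq> (1 - of_nat r :: complex)"
    using \<open>r \<ge> 2\<close> by (simp add: complex_eq_iff)
  ultimately have "\<nexists>a. ?S = {a}"
    by (metis singletonD)
  moreover have "connected ?S"
    by (rule connected_sphere) simp
  ultimately have "q0 islimpt ?S"
    using \<open>q0 \<in> ?S\<close> by (intro connected_imp_perfect) auto
  then have "infinite (?S \<inter> ball q0 \<epsilon>)"
    using \<open>\<epsilon> > 0\<close> islimpt_eq_infinite_ball by blast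
  then have "?S \<inter> ball q0 \<epsilon> - {q. poly p q = 0} \<noteq> {}"
    using fin by (metis Diff_infinite_finite finite.emptyI)
  then obtain q1 where "q1 \<in> ?S" "q1 \<in> ball q0 \<epsilon>" "poly p q1 \<noteq> 0"
    by blast
  then show thesis
    using that[of q1] by (simp add: p dist_norm norm_minus_commute)
qed

text \<open>Injectivity of \<open>w \<mapsto> (w - 1) / (w - \<delta>)\<close>, with
  \<open>w = N / M\<close> in homogeneous form so that \<open>M = 0\<close> is allowed.\<close>

lemma moebius_eqD:
  fixes N :: complex
  assumes eq: "(N - M) / (N - \<delta> * M) = (\<gamma> - 1) / (\<gamma> - \<delta>)"
    and "N \<noteq> \<delta> * M" "\<gamma> \<noteq> \<delta>" "\<delta> \<noteq> 1"
  shows "N = \<gamma> * M"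
proof -
  have "(N - M) * (\<gamma> - \<delta>) = (\<gamma> - 1) * (N - \<delta> * M)"
    using eq assms(2,3) by (simp add: frac_eq_eq)
  then have "(1 - \<delta>) * (N - \<gamma> * M) = 0"
    by (simp add: algebra_simps)
  then show ?thesis
    using \<open>\<delta> \<noteq> 1\<close> by simp
qed

theorem theorem3p11:
  fixes r :: nat
  assumes "r \<ge> 2"
  shows "\<forall>q0 :: complex. cmod (q0 - 1) = real r \<longrightarrow>
           (\<forall>\<epsilon> > 0. \<exists>n0 \<ge> 1. \<forall>n \<ge> n0.
              \<exists>q. poly (leaf_tree_chrom r n) q = 0 \<and> cmod (q - q0) < \<epsilon>)"
proof (intro allI impI, rule ccontr)
  fix q0 :: complex and \<epsilon> :: real
  assume q0: "cmod (q0 - 1) = real r" and "\<epsilon> > 0"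
    and neg: "\<not> (\<exists>n0\<ge>1. \<forall>n\<ge>n0. \<exists>q. poly (leaf_tree_chrom r n) q = 0 \<and> cmod (q - q0) < \<epsilon>)"
  \<comment> \<open>The shift by two matches the omitted functions, which produce roots two levels
    further up.\<close>
  define I where "I = {m. \<forall>q\<in>ball q0 \<epsilon>. poly (leaf_tree_chrom r (Suc (Suc m))) q \<noteq> 0}"
  have "infinite I"
    unfolding infinite_nat_iff_unbounded_le
  proof
    fix m :: nat
    have "Suc (Suc m) \<ge> 1" by simp
    with neg obtain n where n: "n \<ge> Suc (Suc m)" "\<nexists>q. poly (leaf_tree_chrom r n) q = 0 \<and> cmod (q - q0) < \<epsilon>"
      by blast
    then have "n - 2 \<in> I" "n - 2 \<ge> m"
      by (auto simp: I_def dist_norm norm_minus_commute Suc_diff_Suc numeral_2_eq_2)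
    then show "\<exists>n\<ge>m. n \<in> I" by blast
  qed
  obtain q1 where q1: "cmod (q1 - 1) = real r" "dist q0 q1 < \<epsilon>" "(1 - q1) * (q1 - 2) ^ r \<noteq> (q1 - 1) ^ r"
    using generic_point_on_circle[OF assms q0 \<open>\<epsilon> > 0\<close>] .
  have "q1 - 1 \<noteq> 0" using q1(1) assms by auto
  define Q where "Q = (\<lambda>\<xi>. 1 + (q1 - 1) * exp \<xi>)"
  have normQ: "cmod (Q \<xi> - 1) = r * exp (Re \<xi>)" for \<xi>
    by (simp add: Q_def norm_mult q1)
  have ratio: "(exp \<eta> * (r / cmod (Q \<xi> - 1))) ^ n = exp (n * (\<eta> - Re \<xi>))" for \<eta> \<xi> n
  proof -
    have "exp \<eta> * (r / cmod (Q \<xi> - 1)) = exp (\<eta> - Re \<xi>)"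
      using assms by (simp add: normQ exp_diff)
    then show ?thesis by (simp only: exp_of_nat_mult)
  qed
  have "q1 \<in> ball q0 \<epsilon>" using q1 by simp
  then obtain \<rho> \<alpha> \<beta> \<delta> where \<rho>: "\<rho> > 0" "\<And>\<xi>. \<xi> \<in> ball 0 \<rho> \<Longrightarrow> Q \<xi> \<in> ball q0 \<epsilon>"
    and hol: "\<alpha> holomorphic_on ball 0 \<rho>" "\<beta> holomorphic_on ball 0 \<rho>" "\<delta> holomorphic_on ball 0 \<rho>"
    and ne: "\<And>\<xi>. \<xi> \<in> ball 0 \<rho> \<Longrightarrow> \<alpha> \<xi> \<noteq> \<beta> \<xi> \<and> \<alpha> \<xi> \<noteq> \<delta> \<xi> \<and> \<beta> \<xi> \<noteq> \<delta> \<xi> \<and> \<delta> \<xi> \<noteq> 1"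
    and root: "\<And>\<xi> m \<gamma>. \<lbrakk>\<xi> \<in> ball 0 \<rho>; \<gamma> \<in> {\<alpha> \<xi>, \<beta> \<xi>, \<delta> \<xi>};
        poly (orbit_num r m) (Q \<xi>) = \<gamma> * poly (orbit_den r m) (Q \<xi>)\<rbrakk>
       \<Longrightarrow> poly (leaf_tree_chrom r (Suc (Suc m))) (Q \<xi>) = 0"
    using omitted_functions[OF assms q1(1,3) open_ball \<open>q1 \<in> ball q0 \<epsilon>\<close> Q_def] by blast
  define N where "N = (\<lambda>m \<xi>. poly (orbit_num r m) (Q \<xi>))"
  define M where "M = (\<lambda>m \<xi>. poly (orbit_den r m) (Q \<xi>))"
  \<comment> \<open>Written with \<open>N\<close> and \<open>M\<close>, this is holomorphic even at
    poles of \<open>u m\<close>, where it takes the value \<open>1\<close>.\<close>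
  define H where "H = (\<lambda>m \<xi>. (N m \<xi> - M m \<xi>) / (N m \<xi> - \<delta> \<xi> * M m \<xi>))"
  define u where "u = (\<lambda>m \<xi>. N m \<xi> / M m \<xi>)"
  have omit: "N m \<xi> \<noteq> \<gamma> * M m \<xi>" if "m \<in> I" "\<xi> \<in> ball 0 \<rho>" "\<gamma> \<in> {\<alpha> \<xi>, \<beta> \<xi>, \<delta> \<xi>}" for m \<xi> \<gamma>
    using root[OF that(2,3), of m] that(1) \<rho>(2)[OF that(2)] unfolding I_def N_def M_def by blast
  have H_u: "H m \<xi> = (u m \<xi> - 1) / (u m \<xi> - \<delta> \<xi>)" if "M m \<xi> \<noteq> 0" for m \<xi>
  proof -
    have "N m \<xi> = u m \<xi> * M m \<xi>"
      using that by (simp add: u_def)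
    then have "H m \<xi> = ((u m \<xi> - 1) * M m \<xi>) / ((u m \<xi> - \<delta> \<xi>) * M m \<xi>)"
      by (simp add: H_def algebra_simps)
    then show ?thesis using that by simp
  qed
  have holH: "H m holomorphic_on ball 0 \<rho>" if "m \<in> I" for m
  proof -
    have "Q holomorphic_on ball 0 \<rho>"
      unfolding Q_def by (intro holomorphic_intros)
    then have "N m holomorphic_on ball 0 \<rho>" "M m holomorphic_on ball 0 \<rho>"
      unfolding N_def M_def by (auto intro: poly_holomorphic_on)
    then show ?thesis
      unfolding H_def by (intro holomorphic_intros hol) (use omit[OF that] in auto)
  qed

  \<comment> \<open>The Schottky disc around \<open>p\<close> has radius \<open>\<rho> / 2\<close>
    and stays within \<open>3 * \<rho> / 4\<close> of \<open>0\<close>. Three quarters of its radius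
    is \<open>\<rho> / 4 + \<rho> / 8\<close>, just enough to cover the disc of radius
    \<open>s\<close> around \<open>0\<close>.\<close>
  define s where "s = \<rho> / 8"
  have "s > 0" using \<rho> by (simp add: s_def)
  define p where "p = complex_of_real (\<rho> / 4)"
  have big: "cball p (\<rho> / 2) \<subseteq> ball 0 \<rho>"
  proof
    fix z assume "z \<in> cball p (\<rho> / 2)"
    then have "norm z \<le> \<rho> / 2 + norm p"
      using norm_triangle_sub[of z p] by (simp add: dist_norm norm_minus_commute)
    then show "z \<in> ball 0 \<rho>" using \<rho> by (simp add: p_def)
  qed
  have p_in: "p \<in> ball 0 \<rho>" using \<rho> by (simp add: p_def)
  have outside: "cmod (Q \<xi> - 1) > r" if "Re \<xi> > 0" for \<xi>
    using that assms by (simp add: normQ)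
  have tends: "\<forall>\<^sub>F m in sequentially. M m \<xi> \<noteq> 0" "(\<lambda>m. u m \<xi>) \<longlonglongrightarrow> 1" if "Re \<xi> > 0" for \<xi>
    using orbit_tendsto_one[OF assms outside[OF that]] by (simp_all add: M_def N_def u_def)
  have Rep: "Re p > 0" using \<rho> by (simp add: p_def)
  have "(\<lambda>m. (u m p - 1) / (u m p - \<delta> p)) \<longlonglongrightarrow> (1 - 1) / (1 - \<delta> p)"
    by (intro tendsto_intros tends(2)[OF Rep]) (use ne[OF p_in] in auto)
  then have "\<forall>\<^sub>F m in sequentially. norm ((u m p - 1) / (u m p - \<delta> p)) < 1"
    by (intro order_tendstoD(2)[OF tendsto_norm]) auto
  with tends(1)[OF Rep] have "\<forall>\<^sub>F m in sequentially. norm (H m p) < 1"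
    by eventually_elim (simp add: H_u)
  then obtain m0 where m0: "\<And>m. m \<ge> m0 \<Longrightarrow> norm (H m p) < 1"
    unfolding eventually_sequentially by blast
  define J where "J = I \<inter> {m0..}"
  have "infinite J"
    using \<open>infinite I\<close> unfolding infinite_nat_iff_unbounded_le J_def
    by (metis IntI atLeast_iff max.bounded_iff)

  define a where "a = (\<lambda>\<xi>. (\<alpha> \<xi> - 1) / (\<alpha> \<xi> - \<delta> \<xi>))"
  define b where "b = (\<lambda>\<xi>. (\<beta> \<xi> - 1) / (\<beta> \<xi> - \<delta> \<xi>))"
  have ab: "a holomorphic_on ball 0 \<rho>" "b holomorphic_on ball 0 \<rho>"
    unfolding a_def b_def by (intro holomorphic_intros hol; simp add: ne)+
  have a_ne_b: "a \<xi> \<noteq> b \<xi>" if "\<xi> \<in> ball 0 \<rho>" for \<xi>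
    using moebius_eqD[of "\<alpha> \<xi>" 1 "\<delta> \<xi>" "\<beta> \<xi>"] ne[OF that] by (auto simp: a_def b_def)
  have H_omit: "H m \<xi> \<noteq> a \<xi> \<and> H m \<xi> \<noteq> b \<xi>" if "m \<in> I" "\<xi> \<in> ball 0 \<rho>" for m \<xi>
    using moebius_eqD[of "N m \<xi>" "M m \<xi>" "\<delta> \<xi>" "\<alpha> \<xi>"] moebius_eqD[of "N m \<xi>" "M m \<xi>" "\<delta> \<xi>" "\<beta> \<xi>"]
      ne[OF that(2)] omit[OF that, of "\<alpha> \<xi>"] omit[OF that, of "\<beta> \<xi>"] omit[OF that, of "\<delta> \<xi>"]
    by (simp add: H_def a_def b_def) blast
  have "\<exists>C. \<forall>f z. f holomorphic_on cball p (\<rho> / 2) \<longrightarrow>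
     (\<forall>z\<in>cball p (\<rho> / 2). f z \<noteq> a z \<and> f z \<noteq> b z) \<longrightarrow> norm (f p) \<le> 1 \<longrightarrow>
     dist p z \<le> 3 / 4 * (\<rho> / 2) \<longrightarrow> norm (f z) \<le> C"
    by (intro Schottky_two_functions holomorphic_on_subset[OF ab(1) big] holomorphic_on_subset[OF ab(2) big])
      (use a_ne_b big \<rho> in auto)
  then obtain C1 where C1: "\<forall>f z. f holomorphic_on cball p (\<rho> / 2) \<longrightarrow>
     (\<forall>z\<in>cball p (\<rho> / 2). f z \<noteq> a z \<and> f z \<noteq> b z) \<longrightarrow> norm (f p) \<le> 1 \<longrightarrow>
     dist p z \<le> 3 / 4 * (\<rho> / 2) \<longrightarrow> norm (f z) \<le> C1" ..
  have bound: "norm (H m \<xi>) \<le> C1" if "m \<in> J" "norm \<xi> = s" for m \<xi>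
  proof (rule C1[rule_format, of "H m" \<xi>])
    show "H m holomorphic_on cball p (\<rho> / 2)"
      using holH[of m] that big by (auto simp: J_def intro: holomorphic_on_subset)
    show "H m z \<noteq> a z \<and> H m z \<noteq> b z" if "z \<in> cball p (\<rho> / 2)" for z
      using H_omit[of m z] \<open>m \<in> J\<close> big that by (auto simp: J_def)
    show "norm (H m p) \<le> 1"
      using m0[of m] that by (simp add: J_def)
    have "norm (p - \<xi>) \<le> norm p + norm \<xi>"
      by (rule norm_triangle_ineq4)
    then show "dist p \<xi> \<le> 3 / 4 * (\<rho> / 2)"
      using that \<rho> by (simp add: dist_norm p_def s_def)
  qed

  have s_sub: "cball 0 s \<subseteq> ball 0 \<rho>"
    using \<rho> by (auto simp: s_def)
  have cont\<delta>: "continuous_on (cball 0 s) \<delta>"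
    using holomorphic_on_imp_continuous_on[OF hol(3)] s_sub continuous_on_subset by blast
  have "\<exists>x\<in>cball 0 s. \<forall>y\<in>cball 0 s. norm (1 - \<delta> x) \<le> norm (1 - \<delta> y)"
    by (intro continuous_attains_inf continuous_intros cont\<delta>) (use \<open>s > 0\<close> in auto)
  then obtain x0 where x0: "x0 \<in> cball 0 s" "\<And>y. y \<in> cball 0 s \<Longrightarrow> norm (1 - \<delta> x0) \<le> norm (1 - \<delta> y)"
    by blast
  define d where "d = norm (1 - \<delta> x0)"
  have "d > 0"
    using ne[OF subsetD[OF s_sub x0(1)]] by (simp add: d_def)
  \<comment> \<open>\<open>C1\<close> is the Schottky bound; \<open>2 / d\<close> comes from the
    denominator of \<open>H\<close> where \<open>u n\<close> is close to \<open>1\<close>.\<close>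
  define C where "C = max C1 (2 / d)"

  obtain x where x: "0 < x" "x < s / 4" and generic: "\<And>n. N n (of_real x) \<noteq> M n (of_real x)"
    using orbit_generic_on_ray[OF _ \<open>q1 - 1 \<noteq> 0\<close>, of r "s / 4"] \<open>s > 0\<close> assms unfolding N_def M_def Q_def by auto
  show False
  proof (rule two_rate_contradiction[of s J x H C])
    show "H n holomorphic_on cball 0 s" if "n \<in> J" for n
      using holH[of n] that s_sub by (auto simp: J_def intro: holomorphic_on_subset)
    show "norm (H n \<xi>) \<le> C" if "n \<in> J" "norm \<xi> = s" for n \<xi>
      using bound[OF that] by (simp add: C_def)
  next
    fix \<eta> :: real assume "\<eta> > 0"
    \<comment> \<open>With slack \<open>\<eta> / 2\<close> the exponent is at most
      \<open>- n * \<eta> / 2\<close> for \<open>Re \<xi> \<ge> \<eta>\<close>. Thus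
      \<open>u n\<close> tends to \<open>1\<close> uniformly there, and the denominator of
      \<open>H n\<close> is eventually at least \<open>d / 2\<close>.\<close>
    define K where "K = Q ` (cball 0 s \<inter> {\<xi>. Re \<xi> \<ge> \<eta>})"
    have "compact K"
      unfolding K_def Q_def
      by (intro compact_continuous_image continuous_intros compact_Int_closed compact_cball closed_halfspace_Re_ge)
    moreover have "cmod (q - 1) > r" if "q \<in> K" for q
      using that outside \<open>\<eta> > 0\<close> by (auto simp: K_def)
    moreover have "\<eta> / 2 > 0" using \<open>\<eta> > 0\<close> by simp
    ultimately obtain n1 where "\<And>q n. \<lbrakk>q \<in> K; n \<ge> n1\<rbrakk> \<Longrightarrow> poly (orbit_den r n) q \<noteq> 0 \<and>
      cmod (poly (orbit_num r n) q / poly (orbit_den r n) q - 1) \<le> (exp (\<eta> / 2) * (r / cmod (q - 1))) ^ n"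
      using orbit_upper_compact[OF assms, of "\<eta> / 2" K] by metis
    then have n1: "M n \<xi> \<noteq> 0 \<and> norm (u n \<xi> - 1) \<le> exp (n * (\<eta> / 2 - Re \<xi>))"
      if "norm \<xi> = s" "Re \<xi> \<ge> \<eta>" "n \<ge> n1" for n \<xi>
      using that unfolding M_def N_def u_def by (simp add: K_def flip: ratio)
    have "(\<lambda>n. exp (- (\<eta> / 2)) ^ n) \<longlonglongrightarrow> 0"
      using \<open>\<eta> > 0\<close> by (intro LIMSEQ_realpow_zero) auto
    then have "\<forall>\<^sub>F n in sequentially. exp (- (\<eta> / 2)) ^ n < d / 2"
      using \<open>d > 0\<close> by (intro order_tendstoD(2)) auto
    then obtain n2 where n2: "\<And>n. n \<ge> n2 \<Longrightarrow> exp (- (\<eta> / 2)) ^ n < d / 2"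
      unfolding eventually_sequentially by blast
    show "\<exists>n0. \<forall>n\<ge>n0. \<forall>\<xi>. n \<in> J \<longrightarrow> norm \<xi> = s \<longrightarrow> Re \<xi> \<ge> \<eta> \<longrightarrow>
        norm (H n \<xi>) \<le> C * exp (n * (\<eta> - Re \<xi>))"
    proof (intro exI[of _ "max n1 n2"] allI impI)
      fix n \<xi> assume n: "n \<ge> max n1 n2" and \<xi>: "norm \<xi> = s" "Re \<xi> \<ge> \<eta>"
      have u: "M n \<xi> \<noteq> 0" "norm (u n \<xi> - 1) \<le> exp (n * (\<eta> / 2 - Re \<xi>))"
        using n1[OF \<xi>, of n] n by auto
      have "exp (n * (\<eta> / 2 - Re \<xi>)) \<le> exp (n * (- (\<eta> / 2)))"
        using \<xi> by (intro iffD2[OF exp_le_cancel_iff] mult_left_mono) auto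
      also have "\<dots> = exp (- (\<eta> / 2)) ^ n"
        by (rule exp_of_nat_mult)
      also have "\<dots> < d / 2"
        using n2[of n] n by simp
      finally have "norm (u n \<xi> - 1) < d / 2"
        using u(2) by linarith
      moreover have "d \<le> norm (1 - \<delta> \<xi>)"
        unfolding d_def using \<xi> by (intro x0) auto
      moreover have "norm (1 - \<delta> \<xi>) \<le> norm (u n \<xi> - \<delta> \<xi>) + norm (u n \<xi> - 1)"
        using norm_triangle_ineq4[of "u n \<xi> - \<delta> \<xi>" "u n \<xi> - 1"] by simp
      ultimately have "norm (u n \<xi> - \<delta> \<xi>) \<ge> d / 2"
        by linarith
      then have "norm (H n \<xi>) \<le> norm (u n \<xi> - 1) / (d / 2)"
        unfolding H_u[OF u(1)] norm_divide using \<open>d > 0\<close> by (intro divide_left_mono mult_pos_pos) auto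
      also have "\<dots> \<le> exp (n * (\<eta> - Re \<xi>)) / (d / 2)"
      proof (rule divide_right_mono)
        have "exp (n * (\<eta> / 2 - Re \<xi>)) \<le> exp (n * (\<eta> - Re \<xi>))"
          using \<open>\<eta> > 0\<close> by (intro iffD2[OF exp_le_cancel_iff] mult_left_mono) auto
        with u(2) show "norm (u n \<xi> - 1) \<le> exp (n * (\<eta> - Re \<xi>))" by linarith
      qed (use \<open>d > 0\<close> in simp)
      also have "\<dots> = 2 / d * exp (n * (\<eta> - Re \<xi>))"
        by simp
      also have "\<dots> \<le> C * exp (n * (\<eta> - Re \<xi>))"
        by (intro mult_right_mono) (auto simp: C_def)
      finally show "norm (H n \<xi>) \<le> C * exp (n * (\<eta> - Re \<xi>))" .
    qed
  next
    fix \<eta> :: real assume "\<eta> > 0"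
    have Rex: "Re (complex_of_real x) > 0" using x by simp
    obtain c n1 where "c > 0" and n1: "\<And>n. n \<ge> n1 \<Longrightarrow> M n x \<noteq> 0 \<and>
      c * (exp (- \<eta>) * (r / cmod (Q x - 1))) ^ n \<le> norm (u n x - 1)"
      using orbit_lower[OF assms outside[OF Rex] \<open>\<eta> > 0\<close>] generic unfolding M_def N_def u_def by metis
    \<comment> \<open>As \<open>u n x\<close> tends to \<open>1\<close>, the denominator of
      \<open>H n\<close> at \<open>x\<close> is eventually below \<open>D\<close>, so passing from
      \<open>u n - 1\<close> to \<open>H n\<close> costs only a constant factor.\<close>
    define D where "D = norm (1 - \<delta> x) + 1"
    have "D > 0" by (simp add: D_def add_nonneg_pos)
    have "(\<lambda>n. norm (u n x - \<delta> x)) \<longlonglongrightarrow> norm (1 - \<delta> x)"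
      by (intro tendsto_intros tends(2)[OF Rex])
    then have "\<forall>\<^sub>F n in sequentially. norm (u n x - \<delta> x) < D"
      by (rule order_tendstoD(2)) (simp add: D_def)
    then obtain n2 where n2: "\<And>n. n \<ge> n2 \<Longrightarrow> norm (u n x - \<delta> x) < D"
      unfolding eventually_sequentially by blast
    show "\<exists>c>0. \<exists>n0. \<forall>n\<ge>n0. n \<in> J \<longrightarrow> norm (H n (of_real x)) \<ge> c * exp (- (n * (x + \<eta>)))"
    proof (intro exI[of _ "c / D"] exI[of _ "max n1 n2"] conjI allI impI)
      show "c / D > 0" using \<open>c > 0\<close> \<open>D > 0\<close> by simp
      fix n assume n: "n \<ge> max n1 n2" and "n \<in> J"
      have "complex_of_real x \<in> ball 0 \<rho>"
        using x \<rho> by (simp add: s_def)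
      then have "N n x \<noteq> \<delta> x * M n x"
        using omit[of n "of_real x" "\<delta> x"] \<open>n \<in> J\<close> by (simp add: J_def)
      then have "u n x \<noteq> \<delta> x"
        using n1[of n] n by (simp add: u_def divide_eq_eq)
      have "c * exp (- (n * (x + \<eta>))) = c * (exp (- \<eta>) * (r / cmod (Q x - 1))) ^ n"
        unfolding ratio by (simp add: algebra_simps)
      also have "\<dots> \<le> norm (u n x - 1)"
        using n1[of n] n by simp
      finally have "c * exp (- (n * (x + \<eta>))) / D \<le> norm (u n x - 1) / norm (u n x - \<delta> x)"
        using n2[of n] n \<open>u n x \<noteq> \<delta> x\<close> \<open>D > 0\<close> by (intro frac_le) auto
      then show "c / D * exp (- (n * (x + \<eta>))) \<le> norm (H n (of_real x))"
        using n1[of n] n by (simp add: H_u norm_divide)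
    qed
  qed (use \<open>s > 0\<close> \<open>infinite J\<close> x in auto)
qed

end
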